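(* Let $a\in A=\mathbb{F}_q[T]$ with $d:=\deg a>0$ and let $b\in\mathbb{F}_q^{\times}$. Let $f\in k_\infty$ be a root of $X^2-aX-b$ (a quadratic unit), and put $D=a^2+4b$. Then the set $j^{\rm qt}(f)$ has precisely $d=\deg a=\log_q|\sqrt{D}|$ elements, and $$ j^{\rm qt}(f)=\left\{\, j(f)_l:=\frac{1}{\frac{1}{T^q-T}-J(f)_l}\;\right\}_{l=0}^{d-1},$$ where the elements $J(f)_l\in k_\infty$, $0\le l\le d-1$, are the ones defined in the context (in terms of the root of $X^2-aX-b$ of absolute value $>1$), and $1/0$ is read as $\infty$.
   Context: Basic notation. $\mathbb{F}_q$ is the field with $q=p^r$ elements, $A=\mathbb{F}_q[T]$, $k=\mathbb{F}_q(T)$, and $k_\infty=\mathbb{F}_q((1/T))$ is the completion of $k$ for the valuation $v=-\deg_T$, with absolute value $|x|=q^{-v(x)}$ (so $|x|=q^{\deg x}$ for $x\in A\setminus\{0\}$). For $x\in k_\infty$, $\|x\|=\min_{\alpha\in A}|x-\alpha|$ is the distance from $x$ to the nearest element of $A$. Quantum $j$-invariant. For $f\in k_\infty$ and real $\varepsilon>0$ put $\Lambda_\varepsilon(f)=\{\lambda\in A:\ \|\lambda f\|<\varepsilon\}$ and let $\Lambda^{\rm mon}_\varepsilon(f)$ be the set of monic polynomials in $\Lambda_\varepsilon(f)$. For integers $n\ge 1$ let $\zeta_{f,\varepsilon}(n)=\sum_{\lambda\in\Lambda^{\rm mon}_\varepsilon(f)}\lambda^{-n}\in k_\infty$, and let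 $$\tilde J_\varepsilon(f)=\frac{\zeta_{f,\varepsilon}(q^2-1)}{\zeta_{f,\varepsilon}(q-1)^{q+1}},\quad J_\varepsilon(f)=\frac{T^{q^2}-T}{(T^q-T)^{q+1}}\,\tilde J_\varepsilon(f),\quad j_\varepsilon(f)=\frac{1}{\frac{1}{T^q-T}-J_\varepsilon(f)}\in k_\infty\cup\{\infty\}.$$ $j^{\rm qt}(f)\subset k_\infty\cup\{\infty\}$ is the set of all limits of $j_\varepsilon(f)$ as $\varepsilon\to 0$, i.e. the set of all limits of convergent sequences $j_{\varepsilon_i}(f)$ with $\varepsilon_i\to 0$ (convergence to $\infty$ meaning that absolute values tend to infinity). The roots. The polynomial $X^2-aX-b$ has two roots in $k_\infty$, one of absolute value $q^d>1$ and one of absolute value $q^{-d}<1$. Let $f_+$ denote the root with $|f_+|>1$. Let $c\in\mathbb{F}_q^\times$ be such that $ca$ is monic, and put $\bar f=cf_+$. In odd characteristic $\sqrt D$ is the square root of $D$ with $f_+=(a+\sqrt D)/2$; in characteristic $2$, $\sqrt D=a$. The elements $J(f)_l$. For $0\le l\le d-1$ put $d_l=d-1-l$, and for $n\ge 1$ put $\zeta_{T,l}(n)=1+T^{-n}+\cdots+T^{-nd_l}$ and $\zeta_T(n)=\zeta_{T,0}(n)$. Define the (convergent) sums in $k_\infty$ $$H_l(n)=\zeta_{T,l}(n)+\sum_{(c_0,\dots,c_m)}\Big(\sum_{i=0}^m c_i\bar f^{\,i}\Big)^{-n},\qquad H(n)=\frac{\zeta_T(n)}{\bar f^{\,n}-1}+\sum_{(c_1,\dots,c_m)}\Big(\sum_{i=1}^m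 c_i\bar f^{\,i}\Big)^{-n}.$$ In $H_l(n)$ the outer sum runs over all $m\ge 0$ and all tuples $(c_0,\dots,c_m)$ of elements of $A$ with $c_0\neq 0$, $c_m$ monic, $\deg c_i\le d-1$ for all $i$, and $\deg c_0\le d_l$, excluding the tuples with $m=0$ and $c_0=T^j$ for some $0\le j\le d-1$. In $H(n)$ the outer sum runs over all $m\ge 1$ and all tuples $(c_1,\dots,c_m)$ of elements of $A$ with $c_m$ monic and $\deg c_i\le d-1$ for all $i$, excluding the tuples with $c_1=\cdots=c_{m-1}=0$ and $c_m=T^j$ for some $0\le j\le d-1$. (The zero polynomial is allowed where not excluded and counts as having degree $\le$ any bound.) Finally $$\tilde J(f)_l=\frac{H_l(q^2-1)+H(q^2-1)}{\big(H_l(q-1)+H(q-1)\big)^{q+1}},\qquad J(f)_l=\frac{T^{q^2}-T}{(T^q-T)^{q+1}}\,\tilde J(f)_l .$$ *)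

theory Defs
  imports
    Complex_Main
    "HOL-Computational_Algebra.Computational_Algebra"
    "HOL-Library.Cardinality"
    "HOL-Analysis.Infinite_Sum"
begin

(* With 'a a finite field of q elements, 'a poly is F_q[T], and 'a fls, whose
   variable fls_X plays the role of 1/T, is the field F_q((1/T)). Hence
   T = fls_X_inv and the valuation -deg_T is fls_subdegree. *)

definition TT :: "'a::{finite,field} fls" where
  "TT = fls_X_inv"

definition of_A :: "'a::{finite,field} poly \<Rightarrow> 'a fls" where
  "of_A p = poly (map_poly fls_const p) TT"

definition monic :: "'a::{finite,field} poly \<Rightarrow> bool" where
  "monic p \<longleftrightarrow> lead_coeff p = 1"

(* The library metric on 'a fls is a power of 2 with exponent - fls_subdegree (x - y); it induces the
   same topology as absv, so the library's infsum below is the sum for absv. *)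
definition absv :: "'a::{finite,field} fls \<Rightarrow> real" where
  "absv x = (if x = 0 then 0 else real CARD('a) powi (- fls_subdegree x))"

definition dist_A :: "'a::{finite,field} fls \<Rightarrow> real" where
  "dist_A x = (LEAST r. \<exists>\<alpha>. r = absv (x - of_A \<alpha>))"


definition Lam :: "'a::{finite,field} fls \<Rightarrow> real \<Rightarrow> 'a poly set" where
  "Lam f \<epsilon> = {p. dist_A (of_A p * f) < \<epsilon>}"

definition Lam_mon :: "'a::{finite,field} fls \<Rightarrow> real \<Rightarrow> 'a poly set" where
  "Lam_mon f \<epsilon> = {p \<in> Lam f \<epsilon>. monic p}"

definition zeta :: "'a::{finite,field} fls \<Rightarrow> real \<Rightarrow> nat \<Rightarrow> 'a fls" where
  "zeta f \<epsilon> n = (\<Sum>\<^sub>\<infinity>p\<in>Lam_mon f \<epsilon>. 1 / of_A p ^ n)"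

definition J_tilde_eps :: "'a::{finite,field} fls \<Rightarrow> real \<Rightarrow> 'a fls" where
  "J_tilde_eps f \<epsilon> = (let q = CARD('a) in
     zeta f \<epsilon> (q\<^sup>2 - 1) / zeta f \<epsilon> (q - 1) ^ (q + 1))"

definition J_of_J_tilde :: "'a::{finite,field} fls \<Rightarrow> 'a fls" where
  "J_of_J_tilde x = (let q = CARD('a) in
     (TT ^ (q\<^sup>2) - TT) / (TT ^ q - TT) ^ (q + 1) * x)"

(* In 'a fls option, None is the point at infinity. *)
definition j_of_J :: "'a::{finite,field} fls \<Rightarrow> 'a fls option" where
  "j_of_J x = (let y = 1 / (TT ^ CARD('a) - TT) - x in
     if y = 0 then None else Some (1 / y))"

definition j_eps :: "'a::{finite,field} fls \<Rightarrow> real \<Rightarrow> 'a fls option" where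
  "j_eps f \<epsilon> = j_of_J (J_of_J_tilde (J_tilde_eps f \<epsilon>))"

(* Terms equal to infinity have infinite absolute value, so they are allowed
   in a sequence that tends to infinity. *)
definition conv_to :: "(nat \<Rightarrow> 'a::{finite,field} fls option) \<Rightarrow> 'a fls option \<Rightarrow> bool" where
  "conv_to X L = (case L of
     Some x \<Rightarrow> \<forall>e>0. \<forall>\<^sub>F i in sequentially. \<exists>y. X i = Some y \<and> absv (y - x) < e
   | None \<Rightarrow> \<forall>B. \<forall>\<^sub>F i in sequentially. \<forall>y. X i = Some y \<longrightarrow> absv y > B)"

definition j_qt :: "'a::{finite,field} fls \<Rightarrow> 'a fls option set" where
  "j_qt f = {L. \<exists>\<epsilon> :: nat \<Rightarrow> real. (\<forall>i. \<epsilon> i > 0) \<and> \<epsilon> \<longlonglongrightarrow> 0 \<and> conv_to (\<lambda>i. j_eps f (\<epsilon> i)) L}"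


definition quad_poly :: "'a::{finite,field} poly \<Rightarrow> 'a \<Rightarrow> 'a fls poly" where
  "quad_poly a b = [:- fls_const b, - of_A a, 1:]"

definition f_plus :: "'a::{finite,field} poly \<Rightarrow> 'a \<Rightarrow> 'a fls" where
  "f_plus a b = (THE x. poly (quad_poly a b) x = 0 \<and> absv x > 1)"

definition f_bar :: "'a::{finite,field} poly \<Rightarrow> 'a \<Rightarrow> 'a fls" where
  "f_bar a b = fls_const (THE c. c \<noteq> 0 \<and> monic (smult c a)) * f_plus a b"

definition discr :: "'a::{finite,field} poly \<Rightarrow> 'a \<Rightarrow> 'a poly" where
  "discr a b = a\<^sup>2 + 4 * [:b:]"

definition sqrt_discr :: "'a::{finite,field} poly \<Rightarrow> 'a \<Rightarrow> 'a fls" where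
  "sqrt_discr a b =
     (if CHAR('a) = 2 then of_A a
      else (THE s. s\<^sup>2 = of_A (discr a b) \<and> f_plus a b = (of_A a + s) / 2))"


definition zeta_T :: "nat \<Rightarrow> nat \<Rightarrow> nat \<Rightarrow> 'a::{finite,field} fls" where
  "zeta_T d l n = (\<Sum>i\<le>d - 1 - l. 1 / TT ^ (n * i))"

(* The list cs = [c_0, ..., c_m] is the tuple (c_0, ..., c_m), m = length cs - 1. *)
definition tuples_Hl :: "nat \<Rightarrow> nat \<Rightarrow> 'a::{finite,field} poly list set" where
  "tuples_Hl d l = {cs. cs \<noteq> [] \<and> hd cs \<noteq> 0 \<and> monic (last cs) \<and>
     (\<forall>c\<in>set cs. degree c \<le> d - 1) \<and> degree (hd cs) \<le> d - 1 - l \<and>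
     \<not> (\<exists>j\<le>d - 1. cs = [monom 1 j])}"

definition H_l :: "nat \<Rightarrow> 'a::{finite,field} fls \<Rightarrow> nat \<Rightarrow> nat \<Rightarrow> 'a fls" where
  "H_l d fb l n = zeta_T d l n +
     (\<Sum>\<^sub>\<infinity>cs\<in>tuples_Hl d l. 1 / (\<Sum>i<length cs. of_A (cs ! i) * fb ^ i) ^ n)"

(* Here the list cs = [c_1, ..., c_m] is the tuple (c_1, ..., c_m), m = length cs;
   the entry cs ! i is c_(i+1). *)
definition tuples_H :: "nat \<Rightarrow> 'a::{finite,field} poly list set" where
  "tuples_H d = {cs. cs \<noteq> [] \<and> monic (last cs) \<and>
     (\<forall>c\<in>set cs. degree c \<le> d - 1) \<and>
     \<not> ((\<forall>c\<in>set (butlast cs). c = 0) \<and> (\<exists>j\<le>d - 1. last cs = monom 1 j))}"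

definition H :: "nat \<Rightarrow> 'a::{finite,field} fls \<Rightarrow> nat \<Rightarrow> 'a fls" where
  "H d fb n = zeta_T d 0 n / (fb ^ n - 1) +
     (\<Sum>\<^sub>\<infinity>cs\<in>tuples_H d. 1 / (\<Sum>i<length cs. of_A (cs ! i) * fb ^ (i + 1)) ^ n)"

definition J_tilde :: "'a::{finite,field} poly \<Rightarrow> 'a \<Rightarrow> nat \<Rightarrow> 'a fls" where
  "J_tilde a b l = (let q = CARD('a); d = degree a; fb = f_bar a b in
     (H_l d fb l (q\<^sup>2 - 1) + H d fb (q\<^sup>2 - 1)) /
     (H_l d fb l (q - 1) + H d fb (q - 1)) ^ (q + 1))"

definition j_l :: "'a::{finite,field} poly \<Rightarrow> 'a \<Rightarrow> nat \<Rightarrow> 'a fls option" where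
  "j_l a b l = j_of_J (J_of_J_tilde (J_tilde a b l))"

end

theory Submission
  imports Defs
begin

text \<open>
  Write q for the number of constants and d for the degree of a. Multiplying f by a nonzero
  constant, or replacing it by its conjugate a - f, does not change the distance of any of its
  polynomial multiples to A, so the sets \<Lambda> and the limit set stay the same (j_qt_affine).
  Hence f may be replaced by the root x with |x| > 1 of X^2 - aX - b where a is monic. Let y = a - x be the other root, of absolute value q^(-d).

  The polynomials Q_n = (x^(n+1) - y^(n+1)) / (x - y) are monic of degree n d, and
  Q_n x - Q_(n+1) = - y^(n+1). So every polynomial is uniquely a sum of c_i Q_i with digits c_i of
  degree below d, and its product with x is at distance |y| |c_0 + c_1 y + ...| from A, which is
  determined by the first nonzero digit. Therefore the monic elements of \<Lambda> are exactly the sums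
  of c_i Q_(N+i) over i \<ge> 0 in which c_0 has degree at most D; the pair (N, D) depends only on the
  size of \<epsilon> (bij_betw_combo), and N tends to infinity as \<epsilon> tends to 0.

  Up to the common factor x^(N+1) / (x - y), the sum of the c_i Q_(N+i) is the sum of the c_i x^i
  minus a term that tends to 0 uniformly with growing N. The common factor cancels in the quotient
  defining the quantum invariant. So along the \<epsilon> with D = d - 1 - l the quotient
  converges to Z_D(q^2-1) / Z_D(q-1)^(q+1), where Z_D(n) is the sum of (c_0 + c_1 x + ...)^(-n) over
  all such digit sequences (J_tilde_eps_close). Separating the sequences with c_0 = 0 from the others
  identifies Z_D(n) with H_l(n) + H(n) (H_l_plus_H). This gives the description of the limit set,
  with d candidates; a sequence of \<epsilon> whose values converge meets one D infinitely often.

  There remains the distinctness of the candidates (zeta_ratio_distinct). Let D < E < d and let W be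
  the space of polynomials of degree at most D. After removal of the monic elements of W, both Z_D and
  Z_E are sums over cosets of W. Those for Z_E include the coset of T^(D+1), and all others are
  farther from 0. On a coset of W the sum of the (q-1)-st inverse powers has an absolute value that decreases
  strictly with the distance of the coset from 0, and it dominates the sum of the (q^2-1)-st inverse
  powers (coset_sum_bounds). Hence passing from D to E changes Z(q-1) by an element X of absolute
  value exactly \<rho>, where 0 < \<rho> < 1, and Z(q^2-1) by less than \<rho>. Both sums have absolute value 1,
  and (M + X)^(q+1) = M^(q+1) + M^q X + X^q (M + X), so the quotient changes as well.
\<close>

section \<open>The absolute value\<close>

lemma card_field_ge_2: "CARD('a::{finite,field}) \<ge> 2"
proof -
  have "card {0, 1::'a} \<le> CARD('a)" by (intro card_mono) auto
  thus ?thesis by simp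
qed

lemma one_less_card_field [simp]: "Suc 0 < CARD('a::{finite,field})"
  using card_field_ge_2[where 'a='a] by linarith

lemma card_field_gt_1 [simp]: "real CARD('a::{finite,field}) > 1"
  by simp

text \<open>The exponents of the two zeta values are positive, so the terms of the series tend
  to 0.\<close>

lemma card_field_exponents_pos: "0 < CARD('a::{finite,field}) - 1" "0 < CARD('a)\<^sup>2 - 1"
  using one_less_power[of "CARD('a)" 2] by simp_all

lemma card_field_powi_pos [simp]: "real CARD('a::{finite,field}) powi n > 0"
  by (intro zero_less_power_int) simp

lemma card_field_powi_less_iff [simp]:
  "real CARD('a::{finite,field}) powi m < real CARD('a) powi n \<longleftrightarrow> m < n"
  by (meson card_field_gt_1 linorder_not_less power_int_increasing power_int_strict_increasing less_imp_le)

lemma card_field_powi_le_iff [simp]: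
  "real CARD('a::{finite,field}) powi m \<le> real CARD('a) powi n \<longleftrightarrow> m \<le> n"
  by (meson card_field_powi_less_iff linorder_not_less)

lemma absv_0 [simp]: "absv 0 = 0"
  by (simp add: absv_def)

lemma absv_nonzero: "x \<noteq> 0 \<Longrightarrow> absv (x::'a::{finite,field} fls) = real CARD('a) powi (- fls_subdegree x)"
  by (simp add: absv_def)

lemma absv_nonneg [simp]: "absv x \<ge> 0"
  by (simp add: absv_def less_imp_le)

lemma absv_not_neg [simp]: "\<not> absv x < 0"
  by (simp add: not_less)

lemma absv_eq_0_iff [simp]: "absv x = 0 \<longleftrightarrow> x = 0"
  by (simp add: absv_def)

lemma absv_pos_iff [simp]: "absv x > 0 \<longleftrightarrow> x \<noteq> 0"
  using absv_nonneg[of x] absv_eq_0_iff[of x] by (cases "x = 0") (auto simp del: absv_eq_0_iff absv_nonneg)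

lemma absv_mult [simp]: "absv (x * y) = absv x * absv y"
  by (cases "x = 0 \<or> y = 0") (auto simp: absv_def simp flip: power_int_add)

lemma absv_const: "absv (fls_const c) = (if c = 0 then 0 else 1)"
  by (simp add: absv_def)

lemma absv_1 [simp]: "absv 1 = 1"
  by (simp add: absv_def)

lemma absv_minus [simp]: "absv (- x) = absv x"
  by (simp add: absv_def)

lemma absv_minus_commute: "absv (x - y) = absv (y - x)"
  by (metis absv_minus minus_diff_eq)

lemma absv_power [simp]: "absv (x ^ n) = absv x ^ n"
  by (induction n) auto

lemma absv_inverse [simp]: "absv (inverse x) = inverse (absv x)"
  by (simp add: absv_def power_int_minus)

lemma absv_divide [simp]: "absv (x / y) = absv x / absv y"
  by (simp add: divide_inverse)

lemma TT_nonzero [simp]: "(TT :: 'a::{finite,field} fls) \<noteq> 0"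
proof
  assume "(TT :: 'a fls) = 0"
  hence "fls_subdegree (fls_X_inv :: 'a fls) = 0" by (simp add: TT_def)
  thus False by simp
qed

lemma absv_TT [simp]: "absv (TT :: 'a::{finite,field} fls) = real CARD('a)"
  using TT_nonzero[where 'a='a] by (simp add: absv_nonzero) (simp add: TT_def)

text \<open>The dictionary between the absolute value and the coefficients.\<close>

lemma absv_le_powi_iff:
  "absv (x::'a::{finite,field} fls) \<le> real CARD('a) powi (- M) \<longleftrightarrow> (\<forall>n<M. fls_nth x n = 0)"
proof (cases "x = 0")
  case False
  show ?thesis
  proof
    assume "absv x \<le> real CARD('a) powi (- M)"
    hence "M \<le> fls_subdegree x" using False by (simp add: absv_nonzero)
    thus "\<forall>n<M. fls_nth x n = 0" by simp
  next
    assume "\<forall>n<M. fls_nth x n = 0"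
    thus "absv x \<le> real CARD('a) powi (- M)"
      using False by (simp add: absv_nonzero fls_subdegree_geI)
  qed
qed (simp add: less_imp_le)

lemma absv_add_le: "absv (x + y) \<le> max (absv x) (absv y)"
proof (cases "x = 0 \<or> y = 0 \<or> x + y = 0")
  case False
  have "min (fls_subdegree x) (fls_subdegree y) \<le> fls_subdegree (x + y)"
    using False by (intro fls_plus_subdegree) auto
  thus ?thesis using False by (auto simp: absv_nonzero le_max_iff_disj min_le_iff_disj)
qed (auto simp: le_max_iff_disj)

lemma absv_add_leI: "absv x \<le> B \<Longrightarrow> absv y \<le> B \<Longrightarrow> absv (x + y) \<le> B"
  using absv_add_le[of x y] by linarith

lemma absv_add_lessI: "absv x < B \<Longrightarrow> absv y < B \<Longrightarrow> absv (x + y) < B"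
  using absv_add_le[of x y] by linarith

lemma absv_diff_lessI: "absv x < B \<Longrightarrow> absv y < B \<Longrightarrow> absv (x - y) < B"
  using absv_add_lessI[of x B "- y"] by simp

lemma absv_add_dominant: "absv x < absv y \<Longrightarrow> absv (x + y) = absv y"
proof -
  assume *: "absv x < absv y"
  have "absv y \<le> max (absv (x + y)) (absv x)"
    using absv_add_le[of "x + y" "- x"] by simp
  with * absv_add_le[of x y] show ?thesis by linarith
qed

lemma absv_add_dominant': "absv y < absv x \<Longrightarrow> absv (x + y) = absv x"
  using absv_add_dominant[of y x] by (simp add: add.commute)

lemma absv_diff_dominant: "absv x < absv y \<Longrightarrow> absv (y - x) = absv y"
  using absv_add_dominant[of "-x" y] by simp

text \<open>The absolute value is locally constant away from 0: this is how sizes of limits are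
  read off from approximations.\<close>

lemma absv_eq_of_close: "absv (x - y) < absv y \<Longrightarrow> absv x = absv y"
  using absv_add_dominant[of "x - y" y] by simp

lemma absv_sum_le: "0 \<le> B \<Longrightarrow> (\<And>i. i \<in> I \<Longrightarrow> absv (g i) \<le> B) \<Longrightarrow> absv (sum g I) \<le> B"
  by (induction I rule: infinite_finite_induct) (auto intro: absv_add_leI)

lemma absv_sum_less: "0 < B \<Longrightarrow> (\<And>i. i \<in> I \<Longrightarrow> absv (g i) < B) \<Longrightarrow> absv (sum g I) < B"
  by (induction I rule: infinite_finite_induct) (auto intro: absv_add_lessI)

text \<open>Outside the open unit ball, inverse powers are 1-Lipschitz. The bound does not
  depend on x, which makes the convergence of the zeta values uniform in the summation
  variable.\<close>

lemma absv_inverse_power_diff: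
  assumes "absv x \<ge> 1" "absv (y - x) < 1"
  shows "absv (1 / y ^ n - 1 / x ^ n) \<le> absv (y - x)"
proof -
  have y: "absv y = absv x"
    using assms by (intro absv_eq_of_close) linarith
  hence nz: "x \<noteq> 0" "y \<noteq> 0" using assms by auto
  have le: "absv (u / v) \<le> absv u" if "absv v \<ge> 1" for u v :: "'a fls"
  proof -
    have "absv u / absv v \<le> absv u / 1" using that by (intro divide_left_mono) auto
    thus ?thesis by simp
  qed
  show ?thesis
  proof (induction n)
    case 0
    show ?case by simp
  next
    case (Suc n)
    define v where "v = x ^ n"
    define w where "w = 1 / y ^ n - 1 / v"
    have v: "v \<noteq> 0" "absv v \<ge> 1" using nz assms(1) by (simp_all add: v_def)
    have "1 / y ^ Suc n = (w + 1 / v) / y" by (simp add: w_def)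
    also have "\<dots> - 1 / x ^ Suc n = w / y + (x - y) / (x * v * y)"
      using nz v(1) by (simp add: v_def[symmetric] divide_simps) (simp add: algebra_simps)
    finally have eq: "1 / y ^ Suc n - 1 / x ^ Suc n = w / y + (x - y) / (x * v * y)" .
    have "absv w \<le> absv (y - x)" using Suc by (simp only: w_def v_def)
    moreover have "absv (w / y) \<le> absv w" using assms(1) y by (intro le) simp
    moreover have "1 * 1 * 1 \<le> absv x * absv v * absv y"
      using assms(1) v(2) y by (intro mult_mono) auto
    hence "absv ((x - y) / (x * v * y)) \<le> absv (x - y)" by (intro le) simp
    ultimately show ?case
      unfolding eq by (intro absv_add_leI) (simp_all only: absv_minus_commute[of x y])
  qed
qed

section \<open>Convergence and infinite sums\<close>

lemma ex_powi_less:
  assumes "0 < (e::real)"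
  shows "\<exists>M. real CARD('a::{finite,field}) powi (- int M) < e"
proof -
  have "inverse (real CARD('a)) < 1" by (intro iffD2[OF inverse_less_1_iff] disjI2 card_field_gt_1)
  from real_arch_pow_inv[OF assms this] show ?thesis
    by (auto simp: power_int_minus power_inverse)
qed

lemma dist_fls_powi: "dist x (y::'a::group_add fls) = (if x = y then 0 else 2 powi (- fls_subdegree (x - y)))"
  by (auto simp: dist_fls_def power_int_def inverse_eq_divide power_one_over)

lemma dist_fls_less_iff: "dist x (y::'a::{finite,field} fls) < 2 powi (- n) \<longleftrightarrow> absv (x - y) < real CARD('a) powi (- n)"
proof -
  have "(2::real) powi (- fls_subdegree (x - y)) < 2 powi (- n) \<longleftrightarrow> n < fls_subdegree (x - y)"
    by (metis less_imp_le neg_less_iff_less linorder_not_less one_less_numeral_iff power_int_increasing power_int_strict_increasing semiring_norm(76))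
  thus ?thesis by (auto simp: dist_fls_powi absv_nonzero)
qed

text \<open>The metric of the type uses powers of 2 where the absolute value uses powers of q;
  only the topology is the same.\<close>

lemma tendsto_fls_iff:
  "(X \<longlongrightarrow> (x::'a::{finite,field} fls)) F \<longleftrightarrow> (\<forall>e>0. eventually (\<lambda>i. absv (X i - x) < e) F)"
proof
  assume L: "(X \<longlongrightarrow> x) F"
  show "\<forall>e>0. eventually (\<lambda>i. absv (X i - x) < e) F"
  proof (intro allI impI)
    fix e :: real assume "e > 0"
    then obtain M where M: "real CARD('a) powi (- int M) < e" using ex_powi_less by blast
    have "eventually (\<lambda>i. dist (X i) x < 2 powi (- int M)) F"
      by (intro tendstoD[OF L]) (auto intro: zero_less_power_int)
    thus "eventually (\<lambda>i. absv (X i - x) < e) F"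
      by eventually_elim (use M in \<open>simp add: dist_fls_less_iff\<close>)
  qed
next
  assume R: "\<forall>e>0. eventually (\<lambda>i. absv (X i - x) < e) F"
  show "(X \<longlongrightarrow> x) F"
  proof (rule tendstoI)
    fix e :: real assume "e > 0"
    then obtain M where M: "inverse 2 ^ M < e"
      using real_arch_pow_inv[of e "inverse 2"] by auto
    have "eventually (\<lambda>i. absv (X i - x) < real CARD('a) powi (- int M)) F"
      using R by simp
    thus "eventually (\<lambda>i. dist (X i) x < e) F"
    proof eventually_elim
      case (elim i)
      hence "dist (X i) x < 2 powi (- int M)" by (simp only: dist_fls_less_iff)
      also have "\<dots> = inverse 2 ^ M" by (simp only: power_int_minus power_inverse power_int_of_nat)
      finally show ?case using M by linarith
    qed
  qed
qed

text \<open>This makes the general rules for sums and disjoint unions of unconditional sums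
  applicable.\<close>

instance fls :: ("{finite,field}") topological_ab_group_add
proof
  fix a b :: "'a fls"
  show "LIM x nhds a \<times>\<^sub>F nhds b. fst x + snd x :> nhds (a + b)"
    unfolding tendsto_fls_iff
  proof (intro allI impI)
    fix e :: real assume e: "e > 0"
    have fst: "eventually (\<lambda>x. absv (x - a) < e) (nhds a)" for a :: "'a fls"
      using tendsto_fls_iff[of "\<lambda>x. x" a "nhds a"] e by (simp add: filterlim_ident)
    have "eventually (\<lambda>p. absv (fst p - a) < e) (nhds a \<times>\<^sub>F nhds b)"
         "eventually (\<lambda>p. absv (snd p - b) < e) (nhds a \<times>\<^sub>F nhds b)"
      by (rule eventually_compose_filterlim[OF fst filterlim_fst])
         (rule eventually_compose_filterlim[OF fst filterlim_snd])
    thus "eventually (\<lambda>p. absv (fst p + snd p - (a + b)) < e) (nhds a \<times>\<^sub>F nhds b)"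
    proof eventually_elim
      case (elim p)
      thus ?case using absv_add_lessI[of "fst p - a" e "snd p - b"] by (simp add: algebra_simps)
    qed
  qed
next
  fix a :: "'a fls"
  have "((\<lambda>x. x) \<longlongrightarrow> a) (nhds a)" by (rule filterlim_ident)
  moreover have "absv (- x - - a) = absv (x - a)" for x
    using absv_minus[of "x - a"] by (simp del: absv_minus)
  ultimately show "(uminus \<longlongrightarrow> - a) (nhds a)" by (simp only: tendsto_fls_iff)
qed

lemma tendsto_fls_cmult:
  "(X \<longlongrightarrow> (x::'a::{finite,field} fls)) F \<Longrightarrow> ((\<lambda>i. c * X i) \<longlongrightarrow> c * x) F"
proof (cases "c = 0")
  case False
  assume X: "(X \<longlongrightarrow> x) F"
  show ?thesis unfolding tendsto_fls_iff
  proof (intro allI impI)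
    fix e :: real assume "e > 0"
    hence "eventually (\<lambda>i. absv (X i - x) < e / absv c) F"
      using X False by (simp add: tendsto_fls_iff)
    thus "eventually (\<lambda>i. absv (c * X i - c * x) < e) F"
      by eventually_elim (use False in \<open>simp add: pos_less_divide_eq mult.commute flip: right_diff_distrib\<close>)
  qed
qed simp

lemma has_sum_fls_cmult:
  "(g has_sum (s::'a::{finite,field} fls)) I \<Longrightarrow> ((\<lambda>i. c * g i) has_sum (c * s)) I"
  using tendsto_fls_cmult[of "sum g" s "finite_subsets_at_top I" c]
  by (simp add: has_sum_def sum_distrib_left)

text \<open>The ultrametric inequality for infinite sums: the size of a sum is bounded by the
  largest term, however many terms there are.\<close>

lemma has_sum_absv_le:
  assumes "(g has_sum (s::'a::{finite,field} fls)) I" "0 \<le> B" "\<And>i. i \<in> I \<Longrightarrow> absv (g i) \<le> B"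
  shows "absv s \<le> B"
proof (rule ccontr)
  assume "\<not> absv s \<le> B"
  hence gt: "absv s > B" "absv s > 0" using assms(2) by linarith+
  have "eventually (\<lambda>F. absv (sum g F - s) < absv s) (finite_subsets_at_top I)"
    using assms(1) gt by (simp add: has_sum_def tendsto_fls_iff)
  moreover have "eventually (\<lambda>F. absv (sum g F) \<le> B) (finite_subsets_at_top I)"
    by (rule eventually_finite_subsets_at_top_weakI) (use assms in \<open>auto intro!: absv_sum_le\<close>)
  ultimately have "eventually (\<lambda>F. False) (finite_subsets_at_top I)"
    by eventually_elim (use absv_eq_of_close gt in force)
  thus False by simp
qed

lemma has_sum_diff_absv_le:
  assumes "(g has_sum (s::'a::{finite,field} fls)) I" "(h has_sum t) I" "0 \<le> B"
    "\<And>i. i \<in> I \<Longrightarrow> absv (g i - h i) \<le> B"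
  shows "absv (s - t) \<le> B"
proof (rule has_sum_absv_le)
  show "((\<lambda>i. g i - h i) has_sum (s - t)) I"
    using has_sum_add[OF assms(1) has_sum_fls_cmult[OF assms(2), of "-1"]] by simp
qed (use assms in auto)

text \<open>In a complete non-archimedean field a family is summable as soon as its terms tend
  to 0. The sum is built coefficient by coefficient: only finitely many terms contribute to a
  given coefficient.\<close>

lemma summable_on_fls:
  fixes g :: "'i \<Rightarrow> 'a::{finite,field} fls"
  assumes "\<And>e. e > 0 \<Longrightarrow> finite {i \<in> I. absv (g i) \<ge> e}"
  shows "g summable_on I"
proof -
  \<comment> \<open>The terms that may have nonzero coefficients below M.\<close>
  define P where "P = (\<lambda>M::int. {i \<in> I. absv (g i) > real CARD('a) powi (- M)})"
  have finP: "finite (P M)" for M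
    by (rule finite_subset[OF _ assms[of "real CARD('a) powi (- M)"]]) (auto simp: P_def)
  have nthP: "fls_nth (g i) n = 0" if "i \<in> I" "i \<notin> P M" "n < M" for i n M
    using that absv_le_powi_iff[of "g i" M] by (auto simp: P_def)
  define s where "s = Abs_fls (\<lambda>n. \<Sum>i\<in>P (n + 1). fls_nth (g i) n)"
  obtain N where N: "\<forall>i\<in>P 0. N < fls_subdegree (g i)"
  proof -
    have "finite ((\<lambda>i. fls_subdegree (g i)) ` P 0)" using finP by simp
    then obtain N where "\<forall>k\<in>(\<lambda>i. fls_subdegree (g i)) ` P 0. N \<le> k"
      by (meson bdd_below.E bdd_below_finite)
    hence "\<forall>i\<in>P 0. N - 1 < fls_subdegree (g i)" by auto
    thus ?thesis using that by blast
  qed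
  have below: "\<forall>n < min N (-1). (\<Sum>i\<in>P (n + 1). fls_nth (g i) n) = 0"
  proof (intro allI impI sum.neutral ballI)
    fix n i assume n: "n < min N (- 1)" and i: "i \<in> P (n + 1)"
    show "fls_nth (g i) n = 0"
    proof (cases "i \<in> P 0")
      case True
      thus ?thesis using n N by (intro fls_eq0_below_subdegree) (force dest: bspec)
    next
      case False
      thus ?thesis using i n by (intro nthP[of i 0]) (auto simp: P_def)
    qed
  qed
  hence s_nth: "fls_nth s n = (\<Sum>i\<in>P (n + 1). fls_nth (g i) n)" for n
    unfolding s_def using nth_Abs_fls_lower_bound[OF below] by simp
  have "(g has_sum s) I"
    unfolding has_sum_def tendsto_fls_iff
  proof (intro allI impI)
    fix e :: real assume "e > 0"
    then obtain M :: nat where M: "real CARD('a) powi (- int M) < e" using ex_powi_less by blast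
    show "\<forall>\<^sub>F F in finite_subsets_at_top I. absv (sum g F - s) < e"
      unfolding eventually_finite_subsets_at_top
    proof (intro exI[of _ "P M"] conjI allI impI)
      fix F assume F: "finite F \<and> P M \<subseteq> F \<and> F \<subseteq> I"
      have "absv (sum g F - s) \<le> real CARD('a) powi (- int M)"
        unfolding absv_le_powi_iff
      proof (intro allI impI)
        fix n assume n: "n < int M"
        have "P (n + 1) \<subseteq> P M" using n
          by (auto simp: P_def elim!: order.strict_trans1[rotated])
        hence "(\<Sum>i\<in>F. fls_nth (g i) n) = (\<Sum>i\<in>P (n + 1). fls_nth (g i) n)"
          using F by (intro sum.mono_neutral_right) (auto intro: nthP[of _ "n + 1"])
        thus "fls_nth (sum g F - s) n = 0"
          by (simp add: s_nth fls_nth_sum)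
      qed
      thus "absv (sum g F - s) < e" using M by linarith
    qed (use finP in \<open>auto simp: P_def\<close>)
  qed
  thus ?thesis by (auto simp: summable_on_def)
qed

text \<open>Adding one more term to a partial sum that is already close to the limit moves it by
  less than e, so all terms outside of a finite set are small.\<close>

lemma finite_large_terms:
  fixes g :: "'i \<Rightarrow> 'a::{finite,field} fls"
  assumes "g summable_on I" "e > 0"
  shows "finite {i \<in> I. absv (g i) \<ge> e}"
proof -
  obtain s where "(g has_sum s) I" using assms(1) by (auto simp: summable_on_def)
  then obtain F where F: "finite F" "F \<subseteq> I"
    "\<And>G. finite G \<Longrightarrow> F \<subseteq> G \<Longrightarrow> G \<subseteq> I \<Longrightarrow> absv (sum g G - s) < e"
    using assms(2) unfolding has_sum_def tendsto_fls_iff eventually_finite_subsets_at_top by meson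
  have "{i \<in> I. absv (g i) \<ge> e} \<subseteq> F"
  proof (rule ccontr)
    assume "\<not> {i \<in> I. absv (g i) \<ge> e} \<subseteq> F"
    then obtain i where i: "i \<in> I" "i \<notin> F" "absv (g i) \<ge> e" by auto
    have "absv ((sum g (insert i F) - s) - (sum g F - s)) < e"
      using i F by (intro absv_diff_lessI F(3)) auto
    thus False using i F(1) by simp
  qed
  thus ?thesis using F(1) finite_subset by blast
qed

lemma summable_on_fls_subset:
  fixes g :: "'i \<Rightarrow> 'a::{finite,field} fls"
  assumes "g summable_on I" "J \<subseteq> I"
  shows "g summable_on J"
proof (rule summable_on_fls)
  fix e :: real assume "e > 0"
  from finite_large_terms[OF assms(1) this] show "finite {i \<in> J. e \<le> absv (g i)}"
    by (rule finite_subset[rotated]) (use assms(2) in auto)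
qed

section \<open>Sums of inverse powers over cosets of finite-dimensional subspaces\<close>

text \<open>The translation by 1 permutes the field, so q = 0 in it.\<close>

lemma of_nat_card_field: "of_nat CARD('a::{finite,field}) = (0::'a)"
proof -
  have "(\<Sum>x\<in>(UNIV::'a set). x) = (\<Sum>x\<in>UNIV. x + 1)"
    by (rule sum.reindex_bij_witness[of _ "\<lambda>x. x + 1" "\<lambda>x. x - 1"]) auto
  thus ?thesis by (simp add: sum.distrib)
qed

lemma of_nat_card_fls [simp]: "of_nat CARD('a::{finite,field}) = (0::'a fls)"
  using of_nat_card_field[where 'a='a] fls_of_nat[of "CARD('a)", where 'a='a] by simp

lemma power_card_minus_1_field:
  assumes "(c::'a::{finite,field}) \<noteq> 0"
  shows "c ^ (CARD('a) - 1) = 1"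
proof -
  have "(\<Prod>x\<in>UNIV - {0}. x) = (\<Prod>x\<in>UNIV - {0}. c * x)"
    by (rule prod.reindex_bij_witness[of _ "\<lambda>x. c * x" "\<lambda>x. x / c"]) (use assms in auto)
  also have "\<dots> = c ^ (CARD('a) - 1) * (\<Prod>x\<in>UNIV - {0}. x)"
    by (simp add: prod.distrib card_Diff_subset)
  finally show ?thesis by simp
qed

lemma power_card_field: "(c::'a::{finite,field}) ^ CARD('a) = c"
proof (cases "c = 0")
  case False
  have "c ^ CARD('a) = c ^ (CARD('a) - 1) * c"
    using card_field_ge_2[where 'a='a] by (metis One_nat_def Suc_1 Suc_le_D diff_Suc_1 power_Suc2)
  thus ?thesis using power_card_minus_1_field[OF False] by simp
qed simp

lemma fls_const_power_card [simp]: "fls_const (c::'a::{finite,field}) ^ CARD('a) = fls_const c"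
  by (simp add: power_card_field flip: fls_const_power)

text \<open>The constants supply q roots. Polynomial identities of degree below q can therefore
  be checked on constants, where x^q = x.\<close>

lemma poly_fls_eq_0I:
  fixes p :: "'a::{finite,field} fls poly"
  assumes "degree p < CARD('a)" "\<And>c. poly p (fls_const c) = 0"
  shows "p = 0"
proof (rule ccontr)
  assume "p \<noteq> 0"
  have "CARD('a) = card (range (fls_const :: 'a \<Rightarrow> _))"
    by (intro card_image[symmetric] injI) (auto simp: fls_eq_iff dest: spec[of _ 0])
  also have "\<dots> \<le> card {x. poly p x = 0}"
    using \<open>p \<noteq> 0\<close> assms(2) by (intro card_mono poly_roots_finite) auto
  also have "\<dots> \<le> degree p" by (rule card_poly_roots_bound) fact
  finally show False using assms(1) by simp
qed

text \<open>The polynomial (X+1)^q - X^q - 1 has degree below q and vanishes at every constant,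
  hence its coefficients are 0. This yields the additivity of the q-th power directly, without
  writing q as a power of the characteristic.\<close>

lemma binomial_card_fls:
  assumes "0 < i" "i < CARD('a::{finite,field})"
  shows "of_nat (CARD('a) choose i) = (0::'a fls)"
proof -
  let ?q = "CARD('a)"
  define p :: "'a fls poly" where "p = (\<Sum>k\<in>{1..<?q}. monom (of_nat (?q choose k)) k)"
  have q: "{..?q} = insert 0 (insert ?q {1..<?q})" using card_field_ge_2[where 'a='a] by auto
  \<comment> \<open>p is (X+1)^q - X^q - 1 written out; its values at constants are c + 1 - c - 1.\<close>
  have "p = 0"
  proof (rule poly_fls_eq_0I)
    have "degree p \<le> ?q - 1"
      unfolding p_def by (intro degree_sum_le) (auto intro: order.trans[OF degree_monom_le])
    thus "degree p < ?q" using card_field_ge_2[where 'a='a] by linarith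
  next
    fix c :: 'a
    have "(fls_const c + 1) ^ ?q = (\<Sum>k\<le>?q. of_nat (?q choose k) * fls_const c ^ k)"
      by (simp add: binomial_ring)
    also have "\<dots> = 1 + fls_const c + poly p (fls_const c)"
      unfolding q by (simp add: p_def poly_sum poly_monom)
    finally have "fls_const (c + 1) ^ ?q = fls_const (c + 1) + poly p (fls_const c)"
      by (simp flip: fls_plus_const fls_const_1 add: add_ac)
    thus "poly p (fls_const c) = 0" by simp
  qed
  hence "coeff p i = 0" by simp
  thus ?thesis using assms by (simp add: p_def coeff_sum sum.delta)
qed

lemma power_card_add: "(x + y :: 'a::{finite,field} fls) ^ CARD('a) = x ^ CARD('a) + y ^ CARD('a)"
proof -
  let ?q = "CARD('a)"
  have q: "{..?q} = insert 0 (insert ?q {1..<?q})" using card_field_ge_2[where 'a='a] by auto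
  have "(x + y) ^ ?q = (\<Sum>k\<le>?q. of_nat (?q choose k) * x ^ k * y ^ (?q - k))"
    by (rule binomial_ring)
  also have "\<dots> = y ^ ?q + x ^ ?q + (\<Sum>k\<in>{1..<?q}. of_nat (?q choose k) * x ^ k * y ^ (?q - k))"
    unfolding q by simp
  also have "(\<Sum>k\<in>{1..<?q}. of_nat (?q choose k) * x ^ k * y ^ (?q - k)) = 0"
    by (intro sum.neutral) (auto simp: binomial_card_fls)
  finally show ?thesis by simp
qed

lemma power_card_diff: "(x - y :: 'a::{finite,field} fls) ^ CARD('a) = x ^ CARD('a) - y ^ CARD('a)"
  using power_card_add[of "x - y" y] by (simp add: algebra_simps)

lemma power_card_sum: "(sum g I :: 'a::{finite,field} fls) ^ CARD('a) = (\<Sum>i\<in>I. g i ^ CARD('a))"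
  by (induction I rule: infinite_finite_induct) (simp_all add: power_card_add)

lemma power_card_pow_add:
  "(x + y :: 'a::{finite,field} fls) ^ (CARD('a) ^ j) = x ^ (CARD('a) ^ j) + y ^ (CARD('a) ^ j)"
  by (induction j) (simp_all add: power_card_add mult.commute[of "CARD('a)"] power_mult)

lemma fls_const_power_card_pow [simp]: "fls_const (c::'a::{finite,field}) ^ (CARD('a) ^ j) = fls_const c"
  by (induction j) (simp_all add: mult.commute[of "CARD('a)"] power_mult)

text \<open>As a polynomial in z the sum has degree below q - 1, because its top coefficient is
  q = 0. At a constant z exactly one summand vanishes and the others are 1, so the value there is
  q - 1 = - 1.\<close>

lemma sum_shifted_power_card_minus_1:
  "(\<Sum>c\<in>UNIV. (z + fls_const c) ^ (CARD('a) - 1)) = (- 1 :: 'a::{finite,field} fls)"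
proof -
  let ?q = "CARD('a)"
  define p :: "'a fls poly" where "p = (\<Sum>c\<in>UNIV. [:fls_const c, 1:] ^ (?q - 1)) + 1"
  have q: "?q \<ge> 2" by (rule card_field_ge_2)
  have "p = 0"
  proof (rule poly_fls_eq_0I)
    have "degree ([:fls_const c, 1:] ^ (?q - 1)) = ?q - 1" for c :: 'a
      by (subst degree_power_eq) simp_all
    hence "degree p \<le> ?q - 1"
      unfolding p_def by (intro degree_add_le degree_sum_le) (simp_all del: One_nat_def)
    thus "degree p < ?q" using q by linarith
  next
    fix x :: 'a
    have "poly p (fls_const x) = (\<Sum>c\<in>UNIV. (fls_const c + fls_const x) ^ (?q - 1)) + 1"
      by (simp add: p_def poly_sum)
    also have "(\<Sum>c\<in>UNIV. (fls_const c + fls_const x) ^ (?q - 1)) = (\<Sum>c\<in>UNIV - {-x}. 1)"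
    proof (rule sum.mono_neutral_cong_right)
      show "\<forall>c\<in>UNIV - (UNIV - {- x}). (fls_const c + fls_const x) ^ (?q - 1) = 0"
        using q by (auto simp flip: fls_plus_const)
      fix c assume "c \<in> UNIV - {-x}"
      hence "c + x \<noteq> 0" by (auto simp: add_eq_0_iff2)
      thus "(fls_const c + fls_const x) ^ (?q - 1) = 1"
        using power_card_minus_1_field[of "c + x"] by (metis fls_const_power fls_plus_const fls_const_1)
    qed auto
    also have "\<dots> = of_nat (?q - 1)" by (simp add: card_Diff_subset)
    also have "\<dots> + 1 = (of_nat (Suc (?q - 1)) :: 'a fls)" by simp
    also have "Suc (?q - 1) = ?q" using q by simp
    finally show "poly p (fls_const x) = 0" by simp
  qed
  hence "poly p z = 0" by simp
  thus ?thesis by (simp add: p_def poly_sum add_ac eq_neg_iff_add_eq_0)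
qed

text \<open>This is the logarithmic derivative of X^q - X, the product of all X + c. It reduces
  to the previous sum because (z^q - z) / (z + c) = (z + c)^(q-1) - 1.\<close>

lemma sum_inverse_shifted:
  assumes "\<And>c. z \<noteq> fls_const (c::'a::{finite,field})"
  shows "(\<Sum>c\<in>UNIV. 1 / (z + fls_const c)) = - 1 / (z ^ CARD('a) - z)"
proof -
  let ?q = "CARD('a)"
  have q: "?q = Suc (?q - 1)" using card_field_ge_2[where 'a='a] by simp
  have nz: "z + fls_const c \<noteq> 0" for c
    using assms[of "- c"] by (auto simp: add_eq_0_iff2)
  \<comment> \<open>Adding a constant to z does not change z^q - z.\<close>
  have "(z ^ ?q - z) * (1 / (z + fls_const c)) = (z + fls_const c) ^ (?q - 1) - 1" for c
  proof -
    have "z ^ ?q - z = (z + fls_const c) ^ ?q - (z + fls_const c)" by (simp add: power_card_add)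
    also have "\<dots> = ((z + fls_const c) ^ (?q - 1) - 1) * (z + fls_const c)"
      using power_minus_mult[of ?q "z + fls_const c"] by (simp add: left_diff_distrib)
    finally show ?thesis using nz[of c] by simp
  qed
  hence eq: "(z ^ ?q - z) * (\<Sum>c\<in>UNIV. 1 / (z + fls_const c)) = - 1"
    by (simp only: sum_distrib_left sum_subtractf sum_shifted_power_card_minus_1) simp
  hence "z ^ ?q - z \<noteq> 0" by auto
  with eq show ?thesis by (simp add: field_simps)
qed

text \<open>With z = y^(q^j) the term for c equals (y + c) / (z + c) = 1 + (y - z) / (z + c),
  and the ones add up to q = 0. So all exponents q^j - 1 reduce to the sum of the inverses of the
  z + c.\<close>

lemma sum_shifted_inverse_power:
  fixes y :: "'a::{finite,field} fls"
  assumes "absv y > 1"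
  shows "(\<Sum>c\<in>UNIV. 1 / (y + fls_const c) ^ (CARD('a) ^ j - 1))
    = (y ^ (CARD('a) ^ j) - y) / (y ^ CARD('a) - y) ^ (CARD('a) ^ j)"
proof (cases "j = 0")
  case False
  let ?q = "CARD('a)"
  define z where "z = y ^ (?q ^ j)"
  have q: "?q ^ j = Suc (?q ^ j - 1)" by simp
  have z: "z \<noteq> fls_const c" for c
  proof
    assume "z = fls_const c"
    hence "absv z \<le> 1" by (simp add: absv_const)
    moreover have "absv z > 1" using assms by (simp add: z_def one_less_power)
    ultimately show False by simp
  qed
  have nz: "y + fls_const c \<noteq> 0" for c
    using assms absv_const[of "-c"] by (auto simp: add_eq_0_iff2 split: if_splits)
  have nz': "z + fls_const c \<noteq> 0" for c
    using z[of "- c"] by (auto simp: add_eq_0_iff2)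
  have "1 / (y + fls_const c) ^ (?q ^ j - 1) = 1 + (y - z) * (1 / (z + fls_const c))" for c
  proof -
    have "1 / (y + fls_const c) ^ (?q ^ j - 1) = (y + fls_const c) / (y + fls_const c) ^ (?q ^ j)"
      using nz[of c] power_minus_mult[of "?q ^ j" "y + fls_const c"]
      by (simp add: divide_simps mult.commute)
    also have "\<dots> = (y + fls_const c) / (z + fls_const c)"
      by (simp add: power_card_pow_add z_def)
    also have "\<dots> = 1 + (y - z) * (1 / (z + fls_const c))"
      using nz'[of c] by (simp add: field_simps)
    finally show ?thesis .
  qed
  hence "(\<Sum>c\<in>UNIV. 1 / (y + fls_const c) ^ (?q ^ j - 1)) = (y - z) * (\<Sum>c\<in>UNIV. 1 / (z + fls_const c))"
    by (simp add: sum.distrib sum_distrib_left)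
  also have "\<dots> = (z - y) / (z ^ ?q - z)"
    unfolding sum_inverse_shifted[OF z] using minus_divide_left[of "y - z"] by simp
  also have "z ^ ?q - z = (y ^ ?q - y) ^ (?q ^ j)"
  proof -
    have "(y ^ ?q - y) ^ (?q ^ j) + z = z ^ ?q"
      unfolding z_def power_card_pow_add[symmetric] by (simp flip: power_mult add: mult.commute)
    thus ?thesis by (simp add: algebra_simps)
  qed
  finally show ?thesis by (simp add: z_def)
next
  case True
  thus ?thesis by simp
qed

text \<open>The sum of g over the coset x + span(ws), for linearly independent ws. Recursion
  over a basis allows to peel off one line at a time.\<close>

fun coset_sum :: "('a::{finite,field} fls \<Rightarrow> 'a fls) \<Rightarrow> 'a fls list \<Rightarrow> 'a fls \<Rightarrow> 'a fls" where
  "coset_sum g [] x = g x"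
| "coset_sum g (w # ws) x = (\<Sum>c\<in>UNIV. coset_sum g ws (x + fls_const c * w))"

text \<open>The recursion sums along the line of w last; here it is summed first, inside of
  g.\<close>

lemma coset_sum_Cons_inner:
  "coset_sum g (w # ws) x = coset_sum (\<lambda>y. \<Sum>c\<in>UNIV. g (y + fls_const c * w)) ws x"
proof (induction ws arbitrary: x)
  case (Cons v ws)
  have "coset_sum g (w # v # ws) x
      = (\<Sum>c\<in>UNIV. \<Sum>e\<in>UNIV. coset_sum g ws (x + fls_const c * w + fls_const e * v))" by simp
  also have "\<dots> = (\<Sum>e\<in>UNIV. coset_sum g (w # ws) (x + fls_const e * v))"
    by (subst sum.swap) (simp add: add_ac)
  finally show ?case by (simp only: Cons.IH) simp
qed simp

lemma coset_sum_cong: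
  assumes "\<And>w. w \<in> set ws \<Longrightarrow> absv w < absv x" "\<And>y. absv y = absv x \<Longrightarrow> g y = h y"
  shows "coset_sum g ws x = coset_sum h ws x"
  using assms
proof (induction ws arbitrary: x)
  case (Cons w ws)
  have "absv (x + fls_const c * w) = absv x" for c
    using Cons.prems(1)[of w] by (intro absv_add_dominant') (auto simp: absv_const)
  with Cons show ?case by simp
qed simp

lemma coset_sum_linear_image:
  assumes "\<And>x y. \<psi> (x + y) = \<psi> x + \<psi> y" "\<And>c y. \<psi> (fls_const c * y) = fls_const c * \<psi> y"
  shows "coset_sum (\<lambda>y. h (\<psi> y)) ws x = coset_sum h (map \<psi> ws) (\<psi> x)"
  by (induction ws arbitrary: x) (simp_all add: assms)

lemma coset_sum_cmult: "coset_sum (\<lambda>y. s * h y) ws x = s * coset_sum h ws x"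
  by (induction ws arbitrary: x) (simp_all add: sum_distrib_left)

lemma coset_sum_add: "coset_sum (\<lambda>y. g y + h y) ws x = coset_sum g ws x + coset_sum h ws x"
  by (induction ws arbitrary: x) (simp_all add: sum.distrib)

lemma coset_sum_power_card:
  "coset_sum (\<lambda>y. h y ^ CARD('a)) ws x = coset_sum h ws (x::'a::{finite,field} fls) ^ CARD('a)"
  by (induction ws arbitrary: x) (simp_all add: power_card_sum)

text \<open>The linear map with kernel spanned by w. It collapses cosets of that line to points
  and so lowers the dimension of the coset by one.\<close>

definition artin_schreier :: "'a::{finite,field} fls \<Rightarrow> 'a fls \<Rightarrow> 'a fls" where
  "artin_schreier w y = (y / w) ^ CARD('a) - y / w"

lemma artin_schreier_linear:
  "artin_schreier w (x + y) = artin_schreier w x + artin_schreier w y"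
  "artin_schreier w (fls_const c * y) = fls_const c * artin_schreier w y"
  by (simp_all add: artin_schreier_def add_divide_distrib power_card_add power_mult_distrib right_diff_distrib
      flip: times_divide_eq_right)

text \<open>Beyond the kernel the q-th power dominates, so the map preserves the order of
  absolute values.\<close>

lemma absv_artin_schreier:
  assumes "absv w < absv y" "w \<noteq> 0"
  shows "absv (artin_schreier w (y::'a::{finite,field} fls)) = (absv y / absv w) ^ CARD('a)"
proof -
  have "absv (y / w) > 1" using assms by simp
  hence "absv (y / w) < absv ((y / w) ^ CARD('a))"
    using power_strict_increasing[of 1 "CARD('a)" "absv (y / w)"] card_field_ge_2[where 'a='a] by simp
  thus ?thesis unfolding artin_schreier_def by (simp add: absv_diff_dominant)
qed

lemma sum_line_inverse_power:
  assumes "absv w < absv y" "w \<noteq> 0"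
  shows "(\<Sum>c\<in>UNIV. 1 / (y + fls_const c * w) ^ (CARD('a) ^ j - 1))
    = 1 / w ^ (CARD('a) ^ j - 1) *
      (((y / w) ^ (CARD('a) ^ j) - y / w) / artin_schreier w (y::'a::{finite,field} fls) ^ (CARD('a) ^ j))"
proof -
  have *: "y + fls_const c * w = w * (y / w + fls_const c)" for c
    using assms by (simp add: field_simps)
  have "absv (y / w) > 1" using assms by simp
  thus ?thesis
    unfolding * artin_schreier_def
    by (simp add: power_mult_distrib sum_shifted_inverse_power[symmetric] sum_distrib_left)
qed

lemma sum_line_inverse_power_1:
  assumes "absv w < absv y" "w \<noteq> 0"
  shows "(\<Sum>c\<in>UNIV. 1 / (y + fls_const c * w) ^ (CARD('a) - 1))
    = 1 / w ^ (CARD('a) - 1) * (1 / artin_schreier w (y::'a::{finite,field} fls) ^ (CARD('a) - 1))"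
proof -
  have nz: "artin_schreier w y \<noteq> 0" using absv_artin_schreier[OF assms] assms by auto
  have "artin_schreier w y / artin_schreier w y ^ CARD('a) = 1 / artin_schreier w y ^ (CARD('a) - 1)"
    using nz power_minus_mult[of "CARD('a)" "artin_schreier w y"]
    by (simp add: divide_simps mult.commute)
  thus ?thesis using sum_line_inverse_power[OF assms, of 1] by (simp add: artin_schreier_def)
qed

text \<open>Put u = y / w and s = u^q - u. The numerator u^(q^2) - u equals s^q + s, so the sum
  of the (q^2-1)-st inverse powers over a line is the same kind of term at s, plus the q-th power
  of the sum of the (q-1)-st inverse powers.\<close>

lemma sum_line_inverse_power_2:
  assumes "absv w < absv y" "w \<noteq> 0"
  shows "(\<Sum>c\<in>UNIV. 1 / (y + fls_const c * w) ^ (CARD('a)\<^sup>2 - 1))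
    = 1 / w ^ (CARD('a)\<^sup>2 - 1) *
      ((1 / artin_schreier w (y::'a::{finite,field} fls) ^ (CARD('a) - 1)) ^ CARD('a)
        + 1 / artin_schreier w y ^ (CARD('a)\<^sup>2 - 1))"
proof -
  let ?q = "CARD('a)"
  define s where "s = artin_schreier w y"
  define u where "u = y / w"
  have q: "?q \<ge> 2" by (rule card_field_ge_2)
  have nz: "s \<noteq> 0" using absv_artin_schreier[OF assms] assms by (auto simp: s_def)
  have s: "u ^ ?q - u = s" by (simp add: s_def u_def artin_schreier_def)
  have "u ^ ?q\<^sup>2 - u = (u ^ ?q - u) ^ ?q + (u ^ ?q - u)"
    by (simp add: power_card_diff power2_eq_square power_mult)
  hence *: "u ^ ?q\<^sup>2 - u = s ^ ?q + s" by (simp add: s)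
  have 1: "s ^ ?q / s ^ ?q\<^sup>2 = (1 / s ^ (?q - 1)) ^ ?q"
  proof -
    have "?q\<^sup>2 = (?q - 1) * ?q + ?q" using q by (simp add: power2_eq_square algebra_simps)
    hence "s ^ ?q\<^sup>2 = (s ^ (?q - 1)) ^ ?q * s ^ ?q" by (simp add: power_add power_mult)
    thus ?thesis using nz by (simp add: power_divide)
  qed
  have 2: "s / s ^ ?q\<^sup>2 = 1 / s ^ (?q\<^sup>2 - 1)"
  proof -
    have "?q\<^sup>2 = Suc (?q\<^sup>2 - 1)" using q by simp
    hence "s ^ ?q\<^sup>2 = s * s ^ (?q\<^sup>2 - 1)" by (metis power_Suc)
    thus ?thesis using nz by simp
  qed
  show ?thesis
    using sum_line_inverse_power[OF assms, of 2]
    by (simp only: s_def[symmetric] u_def[symmetric] * add_divide_distrib 1 2)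
qed

lemma coset_sum_line_1:
  fixes x :: "'a::{finite,field} fls"
  assumes "\<And>v. v \<in> set (w # ws) \<Longrightarrow> absv v < absv x" "w \<noteq> 0"
  shows "coset_sum (\<lambda>y. 1 / y ^ (CARD('a) - 1)) (w # ws) x =
    1 / w ^ (CARD('a) - 1) *
      coset_sum (\<lambda>y. 1 / y ^ (CARD('a) - 1)) (map (artin_schreier w) ws) (artin_schreier w x)"
  unfolding coset_sum_Cons_inner coset_sum_linear_image[of "artin_schreier w", OF artin_schreier_linear, symmetric]
    coset_sum_cmult[symmetric]
  using assms by (intro coset_sum_cong) (simp_all add: sum_line_inverse_power_1 del: One_nat_def times_divide_eq_left times_divide_eq_right)

lemma coset_sum_line_2:
  fixes x :: "'a::{finite,field} fls"
  assumes "\<And>v. v \<in> set (w # ws) \<Longrightarrow> absv v < absv x" "w \<noteq> 0"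
  shows "coset_sum (\<lambda>y. 1 / y ^ (CARD('a)\<^sup>2 - 1)) (w # ws) x =
    1 / w ^ (CARD('a)\<^sup>2 - 1) *
      (coset_sum (\<lambda>y. 1 / y ^ (CARD('a) - 1)) (map (artin_schreier w) ws) (artin_schreier w x) ^ CARD('a)
      + coset_sum (\<lambda>y. 1 / y ^ (CARD('a)\<^sup>2 - 1)) (map (artin_schreier w) ws) (artin_schreier w x))"
  unfolding coset_sum_Cons_inner coset_sum_power_card[symmetric] coset_sum_add[symmetric]
    coset_sum_linear_image[of "artin_schreier w", OF artin_schreier_linear, symmetric] coset_sum_cmult[symmetric]
  using assms by (intro coset_sum_cong)
    (simp_all add: sum_line_inverse_power_2 del: One_nat_def times_divide_eq_left times_divide_eq_right)

text \<open>The bounds on a coset x + span(ws) go by induction on the dimension. Without ws they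
  compare |x|^(q-1) with |x|^(q^2-1) and with |x'|^(q-1). Otherwise the line of the smallest
  vector w is collapsed. The sum G for the exponent q - 1 only acquires the factor w^(-(q-1)). For
  the exponent q^2 - 1 one obtains G^q + H with the at least as small factor w^(-(q^2-1)), and
  both G^q and H are smaller than G, the first because |G| < 1.\<close>

lemma coset_sum_bounds:
  fixes x :: "'a::{finite,field} fls"
  assumes "sorted_wrt (\<lambda>u v. absv u < absv v) ws" "\<And>w. w \<in> set ws \<Longrightarrow> 1 \<le> absv w"
    "\<And>w. w \<in> set ws \<Longrightarrow> absv w < absv x" "1 < absv x"
  defines "g \<equiv> (\<lambda>y::'a fls. 1 / y ^ (CARD('a) - 1))" and "h \<equiv> (\<lambda>y::'a fls. 1 / y ^ (CARD('a)\<^sup>2 - 1))"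
  shows "0 < absv (coset_sum g ws x) \<and> absv (coset_sum g ws x) < 1 \<and>
    absv (coset_sum h ws x) < absv (coset_sum g ws x) \<and>
    (\<forall>x'. absv x < absv x' \<longrightarrow> absv (coset_sum g ws x') < absv (coset_sum g ws x))"
  using assms(1-4)
proof (induction "length ws" arbitrary: ws x)
  case 0
  have q: "CARD('a) \<ge> 2" by (rule card_field_ge_2)
  have "CARD('a) < CARD('a)\<^sup>2" using q by (simp add: power2_eq_square)
  hence lt: "CARD('a) - 1 < CARD('a)\<^sup>2 - 1" using q by linarith
  have "x \<noteq> 0" using 0 by auto
  have "absv x ^ (CARD('a) - 1) < absv x ^ (CARD('a)\<^sup>2 - 1)"
    using 0 lt by (intro power_strict_increasing)
  moreover have "1 < absv x ^ (CARD('a) - 1)" using 0 q by (intro one_less_power) auto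
  moreover have "absv x ^ (CARD('a) - 1) < absv x' ^ (CARD('a) - 1)" if "absv x < absv x'" for x' :: "'a fls"
    using that q by (intro power_strict_mono) auto
  ultimately show ?case using 0 \<open>x \<noteq> 0\<close>
    by (auto simp: g_def h_def divide_simps intro: less_trans)
next
  case (Suc n)
  then obtain w vs where ws: "ws = w # vs" by (cases ws) auto
  let ?\<psi> = "artin_schreier w"
  have w: "1 \<le> absv w" "absv w < absv x" "w \<noteq> 0" using Suc.prems ws by fastforce+
  have \<psi>: "absv (?\<psi> y) = (absv y / absv w) ^ CARD('a)" if "absv w < absv y" for y
    using absv_artin_schreier[OF that] w by blast
  have mono: "absv (?\<psi> y) < absv (?\<psi> z)" if "absv w < absv y" "absv y < absv z" for y z
    using that w card_field_ge_2[where 'a='a] unfolding \<psi>[OF that(1)] \<psi>[OF less_trans[OF that]]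
    by (intro power_strict_mono divide_strict_right_mono) auto
  have gt1: "1 < absv (?\<psi> y)" if "absv w < absv y" for y
    using that w unfolding \<psi>[OF that] by (intro one_less_power) auto
  have vs: "absv w < absv v" "absv v < absv x" if "v \<in> set vs" for v
    using that Suc.prems by (auto simp: ws)
  define G where "G = (\<lambda>y. coset_sum g (map ?\<psi> vs) (?\<psi> y))"
  define H where "H = coset_sum h (map ?\<psi> vs) (?\<psi> x)"
  have IH: "0 < absv (G x) \<and> absv (G x) < 1 \<and> absv H < absv (G x) \<and>
    (\<forall>x'. absv (?\<psi> x) < absv x' \<longrightarrow> absv (coset_sum g (map ?\<psi> vs) x') < absv (G x))"
    unfolding G_def H_def
  proof (rule Suc.hyps(1))
    show "sorted_wrt (\<lambda>u v. absv u < absv v) (map ?\<psi> vs)"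
      unfolding sorted_wrt_map
      by (rule sorted_wrt_mono_rel[of _ "\<lambda>u v. absv u < absv v"]) (use Suc.prems ws vs mono in auto)
  qed (use Suc.hyps ws vs w mono gt1 in \<open>auto intro: less_imp_le\<close>)
  have sum_g: "coset_sum g ws y = 1 / w ^ (CARD('a) - 1) * G y" if "absv x \<le> absv y" for y
    unfolding G_def g_def ws
    by (intro coset_sum_line_1) (use that w in \<open>auto dest!: vs(2)\<close>)
  have sum_h: "coset_sum h ws x = 1 / w ^ (CARD('a)\<^sup>2 - 1) * (G x ^ CARD('a) + H)"
    unfolding G_def H_def h_def g_def ws
    by (intro coset_sum_line_2) (use w in \<open>auto dest!: vs(2)\<close>)
  define s where "s = absv (1 / w ^ (CARD('a) - 1))"
  have s: "0 < s" "s \<le> 1" using w by (auto simp: s_def divide_simps)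
  have s': "absv (1 / w ^ (CARD('a)\<^sup>2 - 1)) \<le> s"
  proof -
    have "CARD('a) - 1 \<le> CARD('a)\<^sup>2 - 1" by (intro diff_le_mono) (simp add: power2_eq_square)
    hence "absv w ^ (CARD('a) - 1) \<le> absv w ^ (CARD('a)\<^sup>2 - 1)" using w by (intro power_increasing)
    thus ?thesis using w by (simp add: s_def divide_simps)
  qed
  have gx: "absv (coset_sum g ws x) = s * absv (G x)" by (simp add: sum_g s_def)
  have "absv (G x ^ CARD('a)) < absv (G x)"
    using IH card_field_ge_2[where 'a='a] power_strict_decreasing[of 1 "CARD('a)" "absv (G x)"] by simp
  hence "absv (G x ^ CARD('a) + H) < absv (G x)" using IH by (intro absv_add_lessI) auto
  hence "absv (coset_sum h ws x) < s * absv (G x)"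
    unfolding sum_h absv_mult using s' s w by (intro mult_le_less_imp_less) simp_all
  moreover have "absv (coset_sum g ws x') < s * absv (G x)" if "absv x < absv x'" for x'
    using sum_g[of x'] that IH mono[OF w(2) that] s
    by (simp add: s_def G_def del: times_divide_eq_left)
  moreover have "s * absv (G x) < 1"
    using IH s mult_le_one[of s "absv (G x)"] mult_left_le_one_le[of "absv (G x)" s] by linarith
  ultimately show ?case unfolding gx using IH s by auto
qed

section \<open>Polynomials as Laurent series, and digit expansions\<close>

lemma of_A_0 [simp]: "of_A 0 = 0"
  by (simp add: of_A_def)

lemma of_A_pCons [simp]: "of_A (pCons c p) = fls_const c + TT * of_A p"
  by (simp add: of_A_def map_poly_pCons)

lemma of_A_1 [simp]: "of_A 1 = 1"
  by (simp add: one_pCons)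

lemma of_A_add [simp]: "of_A (p + r) = of_A p + of_A r"
  by (induction p r rule: poly_induct2) (simp_all add: algebra_simps flip: fls_plus_const)

lemma of_A_smult [simp]: "of_A (smult c p) = fls_const c * of_A p"
  by (induction p) (simp_all add: algebra_simps)

lemma of_A_mult [simp]: "of_A (p * r) = of_A p * of_A r"
  by (induction p) (simp_all add: algebra_simps)

lemma of_A_minus [simp]: "of_A (- p) = - of_A p"
  using of_A_add[of p "- p"] by (simp add: eq_neg_iff_add_eq_0 add.commute)

lemma of_A_diff [simp]: "of_A (p - r) = of_A p - of_A r"
  using of_A_add[of p "- r"] by simp

lemma of_A_monom: "of_A (monom c j) = fls_const c * TT ^ j"
  by (induction j) (simp_all add: monom_0 monom_Suc mult_ac)

lemma absv_of_A: "p \<noteq> 0 \<Longrightarrow> absv (of_A p) = real CARD('a) ^ degree (p::'a::{finite,field} poly)"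
proof (induction p)
  case (pCons c p)
  show ?case
  proof (cases "p = 0")
    case False
    have "absv (TT * of_A p) = real CARD('a) ^ Suc (degree p)"
      using pCons False by simp
    moreover have "1 < real CARD('a) ^ Suc (degree p)"
      by (intro one_less_power) simp_all
    hence "absv (fls_const c) < real CARD('a) ^ Suc (degree p)"
      by (simp add: absv_const del: power_Suc)
    ultimately show ?thesis
      using False absv_add_dominant[of "fls_const c" "TT * of_A p"] by simp
  qed (use pCons in \<open>simp add: absv_const\<close>)
qed simp

lemma of_A_eq_0_iff [simp]: "of_A p = 0 \<longleftrightarrow> p = 0"
  by (cases "p = 0") (auto dest: absv_of_A)

lemma absv_of_A_ge_1: "p \<noteq> 0 \<Longrightarrow> absv (of_A p) \<ge> 1"
  by (simp add: absv_of_A)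

lemma absv_of_A_le:
  "degree p \<le> n \<Longrightarrow> absv (of_A p) \<le> real CARD('a) ^ n" for p :: "'a::{finite,field} poly"
  by (cases "p = 0") (simp_all add: absv_of_A)

text \<open>Distinct polynomials are at distance at least 1, so an approximation with error
  below 1 is a nearest one.\<close>

lemma dist_A_eqI:
  assumes "absv (x - of_A \<alpha>) < 1"
  shows "dist_A x = absv (x - of_A \<alpha>)"
  unfolding dist_A_def
proof (rule Least_equality)
  fix y assume "\<exists>\<beta>. y = absv (x - of_A \<beta>)"
  then obtain \<beta> where y: "y = absv (x - of_A \<beta>)" by blast
  show "absv (x - of_A \<alpha>) \<le> y"
  proof (cases "\<alpha> = \<beta>")
    case False
    have "absv (x - of_A \<beta>) = absv ((x - of_A \<alpha>) + of_A (\<alpha> - \<beta>))" by simp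
    also have "\<dots> = absv (of_A (\<alpha> - \<beta>))"
      using assms absv_of_A_ge_1[of "\<alpha> - \<beta>"] False by (intro absv_add_dominant) simp
    finally show ?thesis using assms absv_of_A_ge_1[of "\<alpha> - \<beta>"] False y by simp
  qed (simp add: y)
qed blast

text \<open>An expansion with digits in A is a polynomial over A, and this is its value at x. In
  this encoding lengths and leading digits are degrees and leading coefficients, and the zero tail
  needs no bookkeeping.\<close>

definition ev :: "'a::{finite,field} fls \<Rightarrow> 'a poly poly \<Rightarrow> 'a fls" where
  "ev x C = poly (map_poly of_A C) x"

lemma ev_0 [simp]: "ev x 0 = 0"
  by (simp add: ev_def)

lemma ev_pCons [simp]: "ev x (pCons c C) = of_A c + x * ev x C"
  by (simp add: ev_def map_poly_pCons)

lemma ev_Poly: "ev x (Poly cs) = (\<Sum>i<length cs. of_A (cs ! i) * x ^ i)"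
  by (induction cs) (simp_all add: sum.lessThan_Suc_shift sum_distrib_left mult_ac del: sum.lessThan_Suc)

definition has_digits :: "nat \<Rightarrow> 'a::{finite,field} poly poly \<Rightarrow> bool" where
  "has_digits d C \<longleftrightarrow> (\<forall>i. degree (coeff C i) < d)"

lemma has_digits_pCons [simp]: "has_digits d (pCons c C) \<longleftrightarrow> degree c < d \<and> has_digits d C"
  unfolding has_digits_def by (auto simp: coeff_pCons split: nat.splits)

lemma has_digits_0 [simp]: "has_digits d 0 \<longleftrightarrow> d > 0"
  by (simp add: has_digits_def)

lemma has_digits_diff: "has_digits d C \<Longrightarrow> has_digits d D \<Longrightarrow> has_digits d (C - D)"
  unfolding has_digits_def by (auto intro: degree_diff_less)

lemma has_digits_pos: "has_digits d C \<Longrightarrow> d > 0"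
  unfolding has_digits_def by fastforce

text \<open>Digits are smaller than x, so the top term dominates.\<close>

lemma absv_ev_large:
  fixes x :: "'a::{finite,field} fls"
  assumes "has_digits d C" "C \<noteq> 0" "absv x = real CARD('a) ^ d"
  shows "absv (ev x C) = real CARD('a) ^ (d * degree C + degree (lead_coeff C))"
  using assms(1,2)
proof (induction C)
  case (pCons c C)
  show ?case
  proof (cases "C = 0")
    case False
    have 1: "absv (x * ev x C) = real CARD('a) ^ (d + (d * degree C + degree (lead_coeff C)))"
      using pCons False by (simp add: assms(3) power_add)
    have "absv (of_A c) \<le> real CARD('a) ^ degree c" by (intro absv_of_A_le) simp
    also have "\<dots> < absv (x * ev x C)" unfolding 1
      using pCons.prems by (intro power_strict_increasing) auto
    finally have "absv (ev x (pCons c C)) = absv (x * ev x C)"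
      by (simp only: ev_pCons absv_add_dominant)
    thus ?thesis unfolding 1 using False by (simp add: add.assoc)
  qed (use pCons in \<open>simp add: absv_of_A\<close>)
qed simp

lemma absv_ev_small_le:
  fixes y :: "'a::{finite,field} fls"
  assumes "has_digits d C" "absv y \<le> 1"
  shows "absv (ev y C) \<le> real CARD('a) ^ (d - 1)"
  using assms(1)
proof (induction C)
  case (pCons c C)
  have "absv (y * ev y C) \<le> 1 * real CARD('a) ^ (d - 1)"
    unfolding absv_mult using pCons assms by (intro mult_mono) auto
  moreover have "absv (of_A c) \<le> real CARD('a) ^ (d - 1)"
    using pCons.prems by (intro absv_of_A_le) auto
  ultimately show ?case by (simp add: absv_add_leI del: absv_mult)
qed simp

text \<open>Digits are at most q^(d-1) in size and y is of size q^(-d), so everything beyond the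
  lowest digit is below 1; a nonzero lowest digit is not.\<close>

lemma absv_tail_small:
  fixes y :: "'a::{finite,field} fls"
  assumes "has_digits d C" "absv y * real CARD('a) ^ d = 1"
  shows "absv (y * ev y C) < 1"
proof -
  have d: "d > 0" using assms has_digits_pos by blast
  have le1: "absv y \<le> 1" 
    using assms(2) mult_left_mono[of 1 "real CARD('a) ^ d" "absv y"] by (simp add: one_le_power)
  have "absv y \<noteq> 0" using assms(2) by force
  hence pos: "absv y > 0" using absv_nonneg[of y] by linarith
  have "absv (y * ev y C) \<le> absv y * real CARD('a) ^ (d - 1)"
    unfolding absv_mult by (intro mult_left_mono absv_ev_small_le assms le1) simp
  also have "\<dots> < absv y * real CARD('a) ^ d"
    using pos d by (intro mult_strict_left_mono power_strict_increasing) auto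
  finally show ?thesis using assms by simp
qed

lemma absv_ev_small:
  fixes y :: "'a::{finite,field} fls"
  assumes "has_digits d (pCons c C)" "c \<noteq> 0" "absv y * real CARD('a) ^ d = 1"
  shows "absv (ev y (pCons c C)) = real CARD('a) ^ degree c"
proof -
  have "absv (y * ev y C) < absv (of_A c)"
    using absv_tail_small[of d C y] absv_of_A_ge_1[of c] assms by simp
  thus ?thesis using assms by (simp add: absv_add_dominant' absv_of_A)
qed

text \<open>D bounds the degree of the lowest digit only. The zero expansion is excluded by the
  monic leading digit.\<close>

definition expansions :: "nat \<Rightarrow> nat \<Rightarrow> 'a::{finite,field} poly poly set" where
  "expansions d D = {C. monic (lead_coeff C) \<and> has_digits d C \<and> degree (coeff C 0) \<le> D}"

lemma monic_nonzero: "monic p \<Longrightarrow> p \<noteq> 0"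
  by (auto simp: monic_def)

lemma expansions_nonzero: "C \<in> expansions d D \<Longrightarrow> C \<noteq> 0"
  by (auto simp: expansions_def monic_def)

lemma absv_ev_expansions:
  fixes x :: "'a::{finite,field} fls"
  assumes "C \<in> expansions d D" "absv x = real CARD('a) ^ d"
  shows "absv (ev x C) = real CARD('a) ^ (d * degree C + degree (lead_coeff C))"
    and "absv (ev x C) \<ge> 1" and "absv (ev x C) \<ge> real CARD('a) ^ (d * degree C)"
proof -
  show *: "absv (ev x C) = real CARD('a) ^ (d * degree C + degree (lead_coeff C))"
    using assms expansions_nonzero[OF assms(1)] by (intro absv_ev_large) (auto simp: expansions_def)
  show "absv (ev x C) \<ge> 1" unfolding * by (intro one_le_power) simp
  show "absv (ev x C) \<ge> real CARD('a) ^ (d * degree C)"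
    unfolding * by (intro power_increasing) auto
qed

lemma finite_bounded_polys:
  assumes "finite B"
  shows "finite {C :: 'b::zero poly. degree C \<le> m \<and> (\<forall>i. coeff C i \<in> B)}"
proof (rule finite_subset)
  show "{C. degree C \<le> m \<and> (\<forall>i. coeff C i \<in> B)} \<subseteq> Poly ` {cs. set cs \<subseteq> B \<and> length cs \<le> Suc m}"
  proof
    fix C :: "'b poly" assume C: "C \<in> {C. degree C \<le> m \<and> (\<forall>i. coeff C i \<in> B)}"
    have "set (coeffs C) \<subseteq> B" using C by (auto simp: coeffs_def split: if_splits)
    moreover have "length (coeffs C) \<le> Suc m" using C by (auto simp: length_coeffs coeffs_def)
    ultimately show "C \<in> Poly ` {cs. set cs \<subseteq> B \<and> length cs \<le> Suc m}"
      by (intro image_eqI[of _ _ "coeffs C"]) auto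
  qed
qed (intro finite_imageI finite_lists_length_le assms)

lemma finite_expansions_degree: "finite {C \<in> expansions d D. degree C \<le> m}"
proof -
  have "finite {c :: 'a::{finite,field} poly. degree c \<le> d \<and> (\<forall>i. coeff c i \<in> UNIV)}"
    by (rule finite_bounded_polys) simp
  from finite_bounded_polys[OF this, of m] show ?thesis
    by (rule finite_subset[rotated]) (auto simp: expansions_def has_digits_def intro: less_imp_le)
qed

text \<open>The function g is either the evaluation at x or a small perturbation of it.\<close>

lemma summable_expansions:
  fixes x :: "'a::{finite,field} fls"
  assumes "d > 0" "n > 0" "absv x = real CARD('a) ^ d"
    and g: "\<And>C. C \<in> expansions d D \<Longrightarrow> absv (g C) = absv (ev x C)"
  shows "(\<lambda>C. 1 / g C ^ n) summable_on expansions d D"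
proof (rule summable_on_fls)
  fix e :: real assume "e > 0"
  then obtain M where M: "real CARD('a) powi (- int M) < e" using ex_powi_less by blast
  show "finite {C \<in> expansions d D. e \<le> absv (1 / g C ^ n)}"
  proof (rule finite_subset[OF _ finite_expansions_degree[of d D M]], safe)
    fix C assume C: "C \<in> expansions d D" "e \<le> absv (1 / g C ^ n)"
    show "degree C \<le> M"
    proof (rule ccontr)
      assume "\<not> degree C \<le> M"
      hence "M \<le> d * degree C" using assms(1) by (cases d) auto
      hence "real CARD('a) ^ M \<le> real CARD('a) ^ (d * degree C)" by (intro power_increasing) auto
      also have "\<dots> \<le> absv (ev x C)" by (intro absv_ev_expansions(3)[OF C(1)] assms)
      also have "\<dots> \<le> absv (ev x C) ^ n"
        using absv_ev_expansions(2)[OF C(1) assms(3)] assms(2) by (intro self_le_power)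
      finally have "absv (1 / g C ^ n) \<le> 1 / real CARD('a) ^ M"
        using g[OF C(1)] by (simp add: frac_le)
      thus False using M C(2) by (simp add: power_int_minus inverse_eq_divide)
    qed
  qed
qed

text \<open>The limit of the rescaled zeta values along a fixed D.\<close>

definition full_zeta :: "nat \<Rightarrow> nat \<Rightarrow> 'a::{finite,field} fls \<Rightarrow> nat \<Rightarrow> 'a fls" where
  "full_zeta d D x n = (\<Sum>\<^sub>\<infinity>C\<in>expansions d D. 1 / ev x C ^ n)"

lemma has_sum_full_zeta:
  fixes x :: "'a::{finite,field} fls"
  assumes "d > 0" "n > 0" "absv x = real CARD('a) ^ d"
  shows "((\<lambda>C. 1 / ev x C ^ n) has_sum full_zeta d D x n) (expansions d D)"
  unfolding full_zeta_def by (intro has_sum_infsum summable_expansions[OF assms] refl)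

section \<open>The candidate limits are distinct\<close>

text \<open>For n = 0 this is the zero space, which a strict bound on the degree could not
  express.\<close>

definition polys_below :: "nat \<Rightarrow> 'a::{finite,field} poly set" where
  "polys_below n = {p. \<forall>i\<ge>n. coeff p i = 0}"

lemma polys_below_0 [simp]: "polys_below 0 = {0}"
  by (auto simp: polys_below_def poly_eq_iff)

lemma polys_below_degree: "p \<in> polys_below n \<Longrightarrow> n > 0 \<Longrightarrow> degree p < n"
  unfolding polys_below_def
  by (cases "p = 0", simp) (rule ccontr, auto simp: not_less dest: spec[of _ "degree p"])

lemma degree_polys_below: "degree p < n \<Longrightarrow> p \<in> polys_below n"
  by (auto simp: polys_below_def coeff_eq_0)

lemma sum_polys_below_Suc:
  fixes F :: "'a::{finite,field} poly \<Rightarrow> 'b::comm_monoid_add"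
  shows "(\<Sum>p\<in>polys_below (Suc n). F p) = (\<Sum>c\<in>UNIV. \<Sum>p\<in>polys_below n. F (pCons c p))"
  unfolding sum.cartesian_product
proof (rule sum.reindex_bij_witness[of _ "\<lambda>(c, p). pCons c p" "\<lambda>p. (coeff p 0, poly_shift 1 p)"])
  fix p :: "'a poly" assume p: "p \<in> polys_below (Suc n)"
  show *: "(case (coeff p 0, poly_shift 1 p) of (c, p) \<Rightarrow> pCons c p) = p"
    by (simp add: poly_eq_iff coeff_pCons coeff_poly_shift split: nat.splits)
  show "(coeff p 0, poly_shift 1 p) \<in> UNIV \<times> polys_below n"
    using p by (simp add: polys_below_def coeff_poly_shift)
  show "(case (coeff p 0, poly_shift 1 p) of (c, p) \<Rightarrow> F (pCons c p)) = F p"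
    using * by simp
qed (auto simp: polys_below_def coeff_pCons coeff_poly_shift poly_eq_iff split: nat.splits)

lemma coset_sum_powers:
  "coset_sum g (map (\<lambda>i. TT ^ i) [m..<m + n]) x = (\<Sum>p\<in>polys_below n. g (x + TT ^ m * of_A p))"
proof (induction n arbitrary: m x)
  case (Suc n)
  have "[m..<m + Suc n] = m # [Suc m..<Suc m + n]" by (simp add: upt_conv_Cons)
  thus ?case
    by (simp only: list.map coset_sum.simps Suc.IH sum_polys_below_Suc of_A_pCons)
       (simp add: algebra_simps)
qed simp

lemma add_polys_below:
  assumes "p \<in> polys_below n" "0 < n" "n \<le> degree c"
  shows "degree (c + p) = degree c" "lead_coeff (c + p) = lead_coeff c"
proof -
  have "degree p < degree c" using polys_below_degree[OF assms(1,2)] assms(3) by simp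
  thus *: "degree (c + p) = degree c" by (rule degree_add_eq_left)
  show "lead_coeff (c + p) = lead_coeff c"
    unfolding * using \<open>degree p < degree c\<close> by (simp add: coeff_eq_0)
qed

lemma uminus_polys_below: "p \<in> polys_below n \<Longrightarrow> - p \<in> polys_below n"
  by (simp add: polys_below_def)

text \<open>Representatives, with at most m + 1 digits, of the cosets modulo the polynomials of
  degree below n.\<close>

definition high_expansions :: "nat \<Rightarrow> nat \<Rightarrow> nat \<Rightarrow> nat \<Rightarrow> 'a::{finite,field} poly poly set" where
  "high_expansions d D n m =
     {C \<in> expansions d D. degree C \<le> m \<and> (\<forall>j<n. coeff (coeff C 0) j = 0)}"

lemma pCons_in_expansions_iff:
  "pCons c C \<in> expansions d D \<longleftrightarrow>
    degree c < d \<and> degree c \<le> D \<and> has_digits d C \<and> (if C = 0 then monic c else monic (lead_coeff C))"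
  by (auto simp: expansions_def)

text \<open>The last premise keeps the leading digit untouched when the lowest digit is the only
  one.\<close>

lemma expansion_shift_low_digit:
  assumes "pCons c C \<in> expansions d D" "p \<in> polys_below n" "0 < n" "n \<le> Suc D" "n \<le> d"
    "C \<noteq> 0 \<or> n \<le> degree c"
  shows "pCons (c + p) C \<in> expansions d D"
proof -
  have p: "degree p < n" using assms polys_below_degree by blast
  hence "degree (c + p) < d" "degree (c + p) \<le> D"
    using assms degree_add_le[of c D p]
    by (auto simp: pCons_in_expansions_iff intro: degree_add_less)
  thus ?thesis
    using assms(1,6) add_polys_below(2)[OF assms(2,3), of c]
    by (auto simp: pCons_in_expansions_iff monic_def)
qed

text \<open>Expansions are grouped by what remains after the coefficients below T^n of the
  lowest digit are set to 0. This keeps the monic leading digit, except for the one-digit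
  expansions of degree below n, which form the first sum.\<close>

lemma partial_sum_cosets:
  fixes x :: "'a::{finite,field} fls"
  assumes n: "0 < n" "n \<le> Suc D" "n \<le> d"
  shows "(\<Sum>C | C \<in> expansions d D \<and> degree C \<le> m. g (ev x C)) =
    (\<Sum>p | p \<in> polys_below n \<and> monic p. g (of_A p)) +
    (\<Sum>C\<in>high_expansions d D n m. coset_sum g (map (\<lambda>i. TT ^ i) [0..<n]) (ev x C))"
proof -
  define X :: "'a poly poly set" where "X = {C \<in> expansions d D. degree C \<le> m}"
  define L :: "'a poly poly set" where "L = (\<lambda>p. [:p:]) ` {p \<in> polys_below n. monic p}"
  have L: "L \<subseteq> X"
  proof
    fix C assume "C \<in> L"
    then obtain p where p: "C = [:p:]" "p \<in> polys_below n" "monic p" by (auto simp: L_def)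
    have "degree p < n" using p n polys_below_degree by blast
    thus "C \<in> X" using p n by (simp add: X_def pCons_in_expansions_iff)
  qed
  have fin: "finite X" unfolding X_def by (rule finite_expansions_degree)
  have low: "(\<Sum>C\<in>L. g (ev x C)) = (\<Sum>p | p \<in> polys_below n \<and> monic p. g (of_A p))"
    unfolding L_def by (subst sum.reindex) (auto simp: inj_on_def)
  have eq0: "coset_sum g (map (\<lambda>i. TT ^ i) [0..<n]) y = (\<Sum>p\<in>polys_below n. g (y + of_A p))" for y
    using coset_sum_powers[of g 0 n y] by simp
  have "(\<Sum>C\<in>high_expansions d D n m. coset_sum g (map (\<lambda>i. TT ^ i) [0..<n]) (ev x C)) =
    (\<Sum>(C, p)\<in>high_expansions d D n m \<times> polys_below n. g (ev x C + of_A p))"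
    unfolding eq0 by (rule sum.cartesian_product)
  also have "\<dots> = (\<Sum>C\<in>X - L. g (ev x C))"
  proof (rule sum.reindex_bij_witness[of _
      "\<lambda>C. (C - [:poly_cutoff n (coeff C 0):], poly_cutoff n (coeff C 0))" "\<lambda>(C, p). C + [:p:]"], goal_cases)
    case (1 a)
    then obtain C p where a: "a = (C, p)" "C \<in> high_expansions d D n m" "p \<in> polys_below n" by auto
    have "poly_cutoff n (coeff C 0 + p) = p"
      using a by (auto simp: poly_eq_iff coeff_poly_cutoff high_expansions_def polys_below_def not_less)
    thus ?case by (simp add: a)
  next
    case (2 a)
    then obtain C p where a: "a = (C, p)" "C \<in> high_expansions d D n m" "p \<in> polys_below n" by auto
    obtain c C' where C: "C = pCons c C'" by (rule pCons_cases)
    have c: "pCons c C' \<in> expansions d D" "degree C \<le> m" "\<And>j. j < n \<Longrightarrow> coeff c j = 0"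
      using a by (auto simp: high_expansions_def C)
    have deg: "n \<le> degree c" if "c \<noteq> 0"
      using c(3)[of "degree c"] that by (intro leI) auto
    have "C' \<noteq> 0 \<or> n \<le> degree c"
      using deg expansions_nonzero[OF c(1)] by auto
    hence "pCons (c + p) C' \<in> expansions d D" "C' = 0 \<Longrightarrow> degree (c + p) = degree c \<and> n \<le> degree c"
      using expansion_shift_low_digit[OF c(1) a(3) n] add_polys_below(1)[OF a(3) n(1), of c] by auto
    moreover have "pCons (c + p) C' \<notin> L" if "C' = 0 \<Longrightarrow> degree (c + p) = degree c \<and> n \<le> degree c"
      using that polys_below_degree[of "c + p" n] n(1) by (auto simp: L_def)
    moreover have "degree (pCons (c + p) C') \<le> m" using c(2) by (simp add: C)
    ultimately show ?case by (simp add: a C X_def)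
  next
    case (3 C)
    thus ?case by simp
  next
    case (4 C)
    obtain c C' where C: "C = pCons c C'" by (rule pCons_cases)
    define p where "p = poly_cutoff n c"
    have p: "p \<in> polys_below n" by (simp add: p_def polys_below_def coeff_poly_cutoff)
    have c: "pCons c C' \<in> expansions d D" "degree C \<le> m" using 4 by (auto simp: X_def C)
    have "C' \<noteq> 0 \<or> n \<le> degree c"
    proof (rule ccontr)
      assume *: "\<not> (C' \<noteq> 0 \<or> n \<le> degree c)"
      hence "c \<in> polys_below n" "monic c" using c by (auto simp: degree_polys_below pCons_in_expansions_iff)
      thus False using * 4 by (auto simp: L_def C)
    qed
    hence "pCons (c - p) C' \<in> expansions d D"
      using expansion_shift_low_digit[OF c(1) uminus_polys_below[OF p] n] by simp
    moreover have "\<forall>j<n. coeff (c - p) j = 0" by (simp add: p_def coeff_poly_cutoff)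
    moreover have "degree (pCons (c - p) C') \<le> m" using c(2) by (simp add: C)
    ultimately show ?case using p by (simp add: C high_expansions_def p_def)
  next
    case (5 a)
    obtain C p where a: "a = (C, p)" by (cases a)
    obtain c C' where C: "C = pCons c C'" by (rule pCons_cases)
    show ?case by (simp add: a C algebra_simps)
  qed
  finally have "(\<Sum>C\<in>high_expansions d D n m. coset_sum g (map (\<lambda>i. TT ^ i) [0..<n]) (ev x C))
    = (\<Sum>C\<in>X. g (ev x C)) - (\<Sum>C\<in>L. g (ev x C))"
    using sum_diff[OF fin L] by simp
  thus ?thesis unfolding low X_def by simp
qed

lemma coset_sum_powers_bounds:
  fixes x :: "'a::{finite,field} fls"
  assumes "0 < n" "absv x \<ge> real CARD('a) ^ n"
  defines "g \<equiv> (\<lambda>y::'a fls. 1 / y ^ (CARD('a) - 1))" and "h \<equiv> (\<lambda>y::'a fls. 1 / y ^ (CARD('a)\<^sup>2 - 1))"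
    and "ws \<equiv> map (\<lambda>i. TT ^ i :: 'a fls) [0..<n]"
  shows "0 < absv (coset_sum g ws x)" "absv (coset_sum g ws x) < 1"
    "absv (coset_sum h ws x) < absv (coset_sum g ws x)"
    "\<And>x'. absv x < absv x' \<Longrightarrow> absv (coset_sum g ws x') < absv (coset_sum g ws x)"
proof -
  have sorted: "sorted_wrt (\<lambda>u v. absv u < absv v) ws"
    unfolding ws_def sorted_wrt_map
    by (rule sorted_wrt_mono_rel[OF _ sorted_wrt_upt]) simp
  have ge: "1 \<le> absv w" "absv w < absv x" if w: "w \<in> set ws" for w
  proof -
    obtain i where i: "i < n" "w = TT ^ i" using w by (auto simp: ws_def)
    have "real CARD('a) ^ i < real CARD('a) ^ n" using i by (intro power_strict_increasing) auto
    also have "\<dots> \<le> absv x" by fact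
    finally show "absv w < absv x" using i by simp
    show "1 \<le> absv w" using i by (simp add: one_le_power)
  qed
  have "1 < real CARD('a) ^ n" using assms(1) by (intro one_less_power) auto
  hence "1 < absv x" using assms(2) by linarith
  from coset_sum_bounds[OF sorted ge this]
  show "0 < absv (coset_sum g ws x)" "absv (coset_sum g ws x) < 1"
    "absv (coset_sum h ws x) < absv (coset_sum g ws x)"
    "\<And>x'. absv x < absv x' \<Longrightarrow> absv (coset_sum g ws x') < absv (coset_sum g ws x)"
    unfolding g_def h_def by blast+
qed

text \<open>The coset of T^n is the closest one to 0.\<close>

lemma absv_ev_high_expansions:
  fixes x :: "'a::{finite,field} fls"
  assumes "C \<in> high_expansions d D n m" "absv x = real CARD('a) ^ d" "n < d" "C \<noteq> [:monom 1 n:]"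
  shows "absv (ev x C) > real CARD('a) ^ n"
proof -
  obtain c C' where C: "C = pCons c C'" by (rule pCons_cases)
  have C': "C \<in> expansions d D" "\<And>j. j < n \<Longrightarrow> coeff c j = 0"
    using assms by (auto simp: high_expansions_def C)
  have "n < d * degree C + degree (lead_coeff C)"
  proof (cases "C' = 0")
    case True
    have c: "monic c" using C' True by (simp add: C pCons_in_expansions_iff)
    hence "n \<le> degree c" using C'(2)[of "degree c"] by (intro leI) (auto simp: monic_def)
    moreover have "degree c \<noteq> n"
    proof
      assume *: "degree c = n"
      have "coeff c i = coeff (monom 1 n) i" for i
        using C'(2)[of i] c * by (cases i n rule: linorder_cases) (auto simp: monic_def coeff_eq_0)
      hence "c = monom 1 n" by (rule poly_eqI)
      thus False using assms(4) True by (simp add: C)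
    qed
    ultimately show ?thesis using True by (simp add: C)
  qed (use \<open>n < d\<close> in \<open>simp add: C\<close>)
  thus ?thesis unfolding absv_ev_expansions(1)[OF C'(1) assms(2)] by (intro power_strict_increasing) auto
qed

text \<open>With n = D + 1 both partial sums are written over cosets of the polynomials of
  degree at most D. The two sums over monic polynomials of degree at most D cancel, the coset of
  T^n occurs for E only, and all remaining cosets contribute less than it.\<close>

lemma partial_sums_gap:
  fixes x :: "'a::{finite,field} fls"
  assumes "D < E" "E < d" "absv x = real CARD('a) ^ d"
  defines "S \<equiv> (\<lambda>D n m. \<Sum>C | C \<in> expansions d D \<and> degree C \<le> m. 1 / ev x C ^ n)"
  shows "\<exists>\<rho>>0. \<rho> < 1 \<and> (\<forall>m. absv (S E (CARD('a) - 1) m - S D (CARD('a) - 1) m) = \<rho> \<and>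
    absv (S E (CARD('a)\<^sup>2 - 1) m - S D (CARD('a)\<^sup>2 - 1) m) < \<rho>)"
proof -
  define n where "n = Suc D"
  have n: "0 < n" "n \<le> Suc D" "n \<le> Suc E" "n \<le> E" "n < d" "n \<le> d" using assms by (auto simp: n_def)
  define K where "K = (\<lambda>k. coset_sum (\<lambda>y::'a fls. 1 / y ^ k) (map (\<lambda>i. TT ^ i) [0..<n]))"
  define \<rho> where "\<rho> = absv (K (CARD('a) - 1) (TT ^ n))"
  define C0 :: "'a poly poly" where "C0 = [:monom 1 n:]"
  have K: "0 < absv (K (CARD('a) - 1) y)" "absv (K (CARD('a) - 1) y) < 1"
    "absv (K (CARD('a)\<^sup>2 - 1) y) < absv (K (CARD('a) - 1) y)"
    "\<And>z. absv y < absv z \<Longrightarrow> absv (K (CARD('a) - 1) z) < absv (K (CARD('a) - 1) y)"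
    if "absv y \<ge> real CARD('a) ^ n" for y
    using coset_sum_powers_bounds[OF n(1) that] unfolding K_def by blast+
  have evC0: "ev x C0 = TT ^ n" by (simp add: C0_def of_A_monom)
  have \<rho>: "0 < \<rho>" "\<rho> < 1" "absv (K (CARD('a)\<^sup>2 - 1) (TT ^ n)) < \<rho>"
    using K(1-3)[of "TT ^ n"] unfolding \<rho>_def by simp_all
  have less1: "absv (K (CARD('a) - 1) y) < \<rho>" if "absv y > real CARD('a) ^ n" for y
    using K(4)[of "TT ^ n" y] that by (simp add: \<rho>_def)
  have less2: "absv (K (CARD('a)\<^sup>2 - 1) y) < \<rho>" if "absv y > real CARD('a) ^ n" for y
    using K(3)[of y] less1[OF that] that by linarith
  have C0E: "C0 \<in> high_expansions d E n m" for m
    using n by (simp add: C0_def high_expansions_def pCons_in_expansions_iff degree_monom_eq monic_def)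
  have C0D: "C0 \<notin> high_expansions d D n m" for m
    by (simp add: C0_def high_expansions_def pCons_in_expansions_iff degree_monom_eq n_def)
  have fin: "finite (high_expansions d E n m)" for m
    by (rule finite_subset[OF _ finite_expansions_degree[of d E m]]) (auto simp: high_expansions_def)
  have large: "absv (ev x C) > real CARD('a) ^ n"
    if "C \<in> high_expansions d F n m - {C0}" for C m F
    using that absv_ev_high_expansions[OF _ assms(3) n(5)] by (auto simp: C0_def)
  have large': "absv (ev x C) > real CARD('a) ^ n" if "C \<in> high_expansions d D n m" for C m
    using that C0D[of m] by (intro large[of C D m]) auto
  define R where "R = (\<lambda>k m. (\<Sum>C\<in>high_expansions d E n m - {C0}. K k (ev x C)) -
    (\<Sum>C\<in>high_expansions d D n m. K k (ev x C)))"
  have diff: "S E k m - S D k m = K k (TT ^ n) + R k m" for k m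
  proof -
    have "S E k m - S D k m =
      (\<Sum>C\<in>high_expansions d E n m. K k (ev x C)) - (\<Sum>C\<in>high_expansions d D n m. K k (ev x C))"
      unfolding S_def K_def
      using partial_sum_cosets[OF n(1,3,6), where m = m and g = "\<lambda>y. 1 / y ^ k" and x = x]
        partial_sum_cosets[OF n(1,2,6), where m = m and g = "\<lambda>y. 1 / y ^ k" and x = x] by simp
    thus ?thesis
      using sum.remove[OF fin[of m] C0E[of m], where g = "\<lambda>C. K k (ev x C)"] by (simp add: R_def evC0)
  qed
  have R1: "absv (R (CARD('a) - 1) m) < \<rho>" for m
    unfolding R_def
    by (intro absv_diff_lessI absv_sum_less less1 \<rho>(1)) (erule large large')+
  have R2: "absv (R (CARD('a)\<^sup>2 - 1) m) < \<rho>" for m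
    unfolding R_def
    by (intro absv_diff_lessI absv_sum_less less2 \<rho>(1)) (erule large large')+
  show ?thesis
  proof (intro exI[of _ \<rho>] conjI allI)
    fix m
    show "absv (S E (CARD('a) - 1) m - S D (CARD('a) - 1) m) = \<rho>"
      unfolding diff using R1[of m] by (subst absv_add_dominant') (simp_all add: \<rho>_def)
    show "absv (S E (CARD('a)\<^sup>2 - 1) m - S D (CARD('a)\<^sup>2 - 1) m) < \<rho>"
      unfolding diff using R2[of m] \<rho> by (intro absv_add_lessI) auto
  qed (use \<rho> in auto)
qed

lemma full_zeta_approx:
  fixes x :: "'a::{finite,field} fls"
  assumes "d > 0" "n > 0" "absv x = real CARD('a) ^ d" "e > 0"
  shows "\<forall>\<^sub>F m in sequentially.
    absv ((\<Sum>C | C \<in> expansions d D \<and> degree C \<le> m. 1 / ev x C ^ n) - full_zeta d D x n) < e"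
proof -
  obtain F where F: "finite F" "F \<subseteq> expansions d D"
    "\<And>G. finite G \<Longrightarrow> F \<subseteq> G \<Longrightarrow> G \<subseteq> expansions d D \<Longrightarrow>
      absv ((\<Sum>C\<in>G. 1 / ev x C ^ n) - full_zeta d D x n) < e"
    using has_sum_full_zeta[OF assms(1-3), of D] assms(4)
    unfolding has_sum_def tendsto_fls_iff eventually_finite_subsets_at_top by meson
  obtain M where "\<And>C. C \<in> F \<Longrightarrow> degree C \<le> M"
    using finite_nat_set_iff_bounded_le[of "degree ` F"] F(1) by auto
  hence "F \<subseteq> {C \<in> expansions d D. degree C \<le> m}" if "m \<ge> M" for m
    using that F(2) by (auto intro: order.trans)
  thus ?thesis
    unfolding eventually_sequentially using F(3)[OF finite_expansions_degree] by blast
qed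

text \<open>The gap of the partial sums does not depend on the cut-off, so it survives in the
  limit.\<close>

lemma full_zeta_gap:
  fixes x :: "'a::{finite,field} fls"
  assumes "D < E" "E < d" "absv x = real CARD('a) ^ d"
  shows "\<exists>\<rho>>0. \<rho> < 1 \<and> absv (full_zeta d E x (CARD('a) - 1) - full_zeta d D x (CARD('a) - 1)) = \<rho> \<and>
    absv (full_zeta d E x (CARD('a)\<^sup>2 - 1) - full_zeta d D x (CARD('a)\<^sup>2 - 1)) < \<rho>"
proof -
  define S where "S = (\<lambda>D n m. \<Sum>C | C \<in> expansions d D \<and> degree C \<le> m. 1 / ev x C ^ n)"
  have d: "d > 0" using assms by simp
  obtain \<rho> where \<rho>: "0 < \<rho>" "\<rho> < 1"
    "\<And>m. absv (S E (CARD('a) - 1) m - S D (CARD('a) - 1) m) = \<rho>"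
    "\<And>m. absv (S E (CARD('a)\<^sup>2 - 1) m - S D (CARD('a)\<^sup>2 - 1) m) < \<rho>"
    using partial_sums_gap[OF assms] unfolding S_def by blast
  have approx: "\<exists>m. absv ((full_zeta d E x k - full_zeta d D x k) - (S E k m - S D k m)) < \<rho>"
    if "k > 0" for k
  proof -
    have S: "\<forall>\<^sub>F m in sequentially. absv (S F k m - full_zeta d F x k) < \<rho>" for F
      using full_zeta_approx[OF d that assms(3) \<rho>(1), of F] by (simp only: S_def)
    \<comment> \<open>One cut-off serves both sums.\<close>
    have "\<forall>\<^sub>F m in sequentially. absv ((full_zeta d E x k - full_zeta d D x k) - (S E k m - S D k m)) < \<rho>"
      using S[of D] S[of E]
    proof eventually_elim
      case (elim m)
      have "absv ((S D k m - full_zeta d D x k) - (S E k m - full_zeta d E x k)) < \<rho>"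
        using elim by (rule absv_diff_lessI)
      thus ?case by (simp add: algebra_simps)
    qed
    thus ?thesis by (auto simp: eventually_sequentially)
  qed
  note pos = card_field_exponents_pos[where 'a='a]
  obtain m where m: "absv ((full_zeta d E x (CARD('a) - 1) - full_zeta d D x (CARD('a) - 1))
      - (S E (CARD('a) - 1) m - S D (CARD('a) - 1) m)) < \<rho>"
    using approx[OF pos(1)] by blast
  obtain m' where m': "absv ((full_zeta d E x (CARD('a)\<^sup>2 - 1) - full_zeta d D x (CARD('a)\<^sup>2 - 1))
      - (S E (CARD('a)\<^sup>2 - 1) m' - S D (CARD('a)\<^sup>2 - 1) m')) < \<rho>"
    using approx[OF pos(2)] by blast
  show ?thesis
  proof (intro exI[of _ \<rho>] conjI \<rho>(1,2))
    show "absv (full_zeta d E x (CARD('a) - 1) - full_zeta d D x (CARD('a) - 1)) = \<rho>"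
      using absv_eq_of_close[of _ "S E (CARD('a) - 1) m - S D (CARD('a) - 1) m"] m \<rho>(3)[of m] by simp
    show "absv (full_zeta d E x (CARD('a)\<^sup>2 - 1) - full_zeta d D x (CARD('a)\<^sup>2 - 1)) < \<rho>"
      using absv_add_lessI[OF m' \<rho>(4)[of m']] by simp
  qed
qed

text \<open>The expansion 1 contributes 1 and every other expansion is larger than 1.\<close>

lemma absv_full_zeta:
  fixes x :: "'a::{finite,field} fls"
  assumes "d > 0" "n > 0" "absv x = real CARD('a) ^ d"
  shows "absv (full_zeta d D x n) = 1"
proof -
  have 1: "1 \<in> expansions d D"
    using assms(1) by (simp add: one_pCons pCons_in_expansions_iff monic_def)
  have gt: "absv (ev x C) \<ge> real CARD('a)" if "C \<in> expansions d D - {1}" for C :: "'a poly poly"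
  proof -
    obtain c C' where C: "C = pCons c C'" by (rule pCons_cases)
    have "d * degree C + degree (lead_coeff C) \<ge> 1"
    proof (rule ccontr)
      assume "\<not> d * degree C + degree (lead_coeff C) \<ge> 1"
      hence "degree C = 0" "degree (lead_coeff C) = 0" using assms(1) by (cases "degree C"; simp)+
      then obtain e where "C = [:[:e:]:]" 
        using degree_0_id[of C] degree_0_id[of "coeff C 0"] by metis
      thus False using that
        by (auto simp: expansions_def monic_def one_pCons)
    qed
    hence "real CARD('a) ^ 1 \<le> real CARD('a) ^ (d * degree C + degree (lead_coeff C))"
      by (intro power_increasing) auto
    thus ?thesis using absv_ev_expansions(1)[of C d D x] that assms(3) by simp
  qed
  have "absv (full_zeta d D x n - (\<Sum>C\<in>{1}. 1 / ev x C ^ n)) \<le> 1 / real CARD('a)"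
  proof (rule has_sum_absv_le)
    show "((\<lambda>C. 1 / ev x C ^ n) has_sum (full_zeta d D x n - (\<Sum>C\<in>{1}. 1 / ev x C ^ n))) (expansions d D - {1})"
      by (intro has_sum_Diff has_sum_full_zeta assms has_sum_finite) (use 1 in auto)
    fix C :: "'a poly poly" assume C: "C \<in> expansions d D - {1}"
    have "real CARD('a) \<le> absv (ev x C) ^ n"
      using gt[OF C] self_le_power[of "absv (ev x C)" n] assms(2) card_field_gt_1[where 'a='a] by linarith
    thus "absv (1 / ev x C ^ n) \<le> 1 / real CARD('a)" by (simp add: frac_le)
  qed simp
  also have "1 / real CARD('a) < 1" by simp
  finally have "absv (full_zeta d D x n - 1) < absv (1 :: 'a fls)" by (simp add: one_pCons)
  hence "absv (full_zeta d D x n) = absv (1 :: 'a fls)" by (rule absv_eq_of_close)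
  thus ?thesis by simp
qed

definition zeta_ratio :: "nat \<Rightarrow> nat \<Rightarrow> 'a::{finite,field} fls \<Rightarrow> 'a fls" where
  "zeta_ratio d D x = full_zeta d D x (CARD('a)\<^sup>2 - 1) / full_zeta d D x (CARD('a) - 1) ^ (CARD('a) + 1)"

lemma zeta_ratio_distinct:
  fixes x :: "'a::{finite,field} fls"
  assumes "D < E" "E < d" "absv x = real CARD('a) ^ d"
  shows "zeta_ratio d D x \<noteq> zeta_ratio d E x"
proof
  let ?q = "CARD('a)"
  define M M' N N' where "M = full_zeta d D x (?q - 1)" and "M' = full_zeta d E x (?q - 1)"
    and "N = full_zeta d D x (?q\<^sup>2 - 1)" and "N' = full_zeta d E x (?q\<^sup>2 - 1)"
  obtain \<rho> where \<rho>: "0 < \<rho>" "\<rho> < 1" "absv (M' - M) = \<rho>" "absv (N' - N) < \<rho>"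
    using full_zeta_gap[OF assms] unfolding M_def M'_def N_def N'_def by blast
  have "0 < d" using assms by simp
  note pos = card_field_exponents_pos[where 'a='a] this
  have 1: "absv M = 1" "absv M' = 1" "absv N = 1"
    using absv_full_zeta[OF pos(3,1) assms(3)] absv_full_zeta[OF pos(3,2) assms(3)]
    by (simp_all add: M_def M'_def N_def)
  hence nz: "M \<noteq> 0" "M' \<noteq> 0" by auto
  define X where "X = M' - M"
  have M': "M' = M + X" by (simp add: X_def)
  assume "zeta_ratio d D x = zeta_ratio d E x"
  hence "N / M ^ (?q + 1) = N' / M' ^ (?q + 1)"
    by (simp add: zeta_ratio_def M_def M'_def N_def N'_def)
  hence "N * M' ^ (?q + 1) = N' * M ^ (?q + 1)" using nz by (simp add: divide_simps)
  hence "(N' - N) * M ^ (?q + 1) = N * (M' ^ (?q + 1) - M ^ (?q + 1))"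
    by (simp add: algebra_simps)
  also have "M' ^ (?q + 1) - M ^ (?q + 1) = M ^ ?q * X + X ^ ?q * M'"
    by (simp add: M' power_card_add algebra_simps)
  finally have "absv ((N' - N) * M ^ (?q + 1)) = absv (N * (M ^ ?q * X + X ^ ?q * M'))"
    by (rule arg_cong)
  hence "absv (N' - N) = absv (M ^ ?q * X + X ^ ?q * M')"
    by (simp only: absv_mult absv_power 1 power_one mult_1_left mult_1_right)
  also have "\<dots> = absv (M ^ ?q * X)"
  proof (rule absv_add_dominant')
    have "\<rho> ^ ?q < \<rho> ^ 1" using \<rho> by (intro power_strict_decreasing) auto
    thus "absv (X ^ ?q * M') < absv (M ^ ?q * X)" using \<rho> 1 by (simp add: X_def)
  qed
  also have "\<dots> = \<rho>" using \<rho> 1 by (simp add: X_def)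
  finally show False using \<rho> by simp
qed

section \<open>Small multiples of a quadratic unit\<close>

text \<open>The continuants of the quadratic unit: for b = 1 they are the denominators of the
  convergents of its continued fraction [a; a, a, ...].\<close>

fun denom :: "'a::{finite,field} poly \<Rightarrow> 'a \<Rightarrow> nat \<Rightarrow> 'a poly" where
  "denom a b 0 = 1"
| "denom a b (Suc 0) = a"
| "denom a b (Suc (Suc n)) = a * denom a b (Suc n) + smult b (denom a b n)"

definition combo :: "'a::{finite,field} poly \<Rightarrow> 'a \<Rightarrow> nat \<Rightarrow> 'a poly poly \<Rightarrow> 'a poly" where
  "combo a b N C = (\<Sum>i\<le>degree C. coeff C i * denom a b (N + i))"

lemma combo_0 [simp]: "combo a b N 0 = 0"
  by (simp add: combo_def)

text \<open>Dropping the lowest digit raises the starting index N.\<close>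

lemma combo_pCons [simp]: "combo a b N (pCons c C) = c * denom a b N + combo a b (Suc N) C"
  by (cases "C = 0") (simp_all add: combo_def sum.atMost_Suc_shift del: sum.atMost_Suc)

lemma combo_add: "combo a b N (C + D) = combo a b N C + combo a b N D"
  by (induction C D arbitrary: N rule: poly_induct2) (simp_all add: algebra_simps)

lemma combo_monom: "combo a b N (monom c m) = c * denom a b (N + m)"
  by (induction m arbitrary: N) (simp_all add: monom_0 monom_Suc)

text \<open>The normalised situation: a is monic and x is the root of absolute value larger than
  1.\<close>

locale quadratic_unit =
  fixes a :: "'a::{finite,field} poly" and b :: 'a and x :: "'a fls"
  assumes deg_pos: "degree a > 0" and monic_a: "monic a" and b_nonzero: "b \<noteq> 0"
    and root: "x\<^sup>2 = of_A a * x + fls_const b" and large: "absv x > 1"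
begin

definition y :: "'a fls" where "y = of_A a - x"

abbreviation d :: nat where "d \<equiv> degree a"

lemma a_nonzero: "a \<noteq> 0"
  using deg_pos by auto

lemma x_nonzero: "x \<noteq> 0"
  using large by auto

lemma xy: "x * y = - fls_const b"
  using root by (simp add: y_def algebra_simps power2_eq_square)

lemma absv_xy: "absv x * absv y = 1"
  unfolding absv_mult[symmetric] xy using b_nonzero by (simp add: absv_const)

lemma absv_y_less_1: "absv y < 1"
proof -
  have "absv y = 1 / absv x" using absv_xy x_nonzero by (simp add: field_simps)
  thus ?thesis using large by (simp add: divide_less_eq_1)
qed

lemma absv_x: "absv x = real CARD('a) ^ d"
proof -
  have "absv x = absv (of_A a - y)" by (simp add: y_def)
  also have "\<dots> = absv (of_A a)"
    using absv_y_less_1 absv_of_A_ge_1[OF a_nonzero] by (intro absv_diff_dominant) linarith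
  also have "\<dots> = real CARD('a) ^ d" using a_nonzero by (rule absv_of_A)
  finally show ?thesis .
qed

lemma absv_y: "absv y * real CARD('a) ^ d = 1"
  using absv_xy absv_x by (simp add: mult.commute)

lemma x_neq_y: "x - y \<noteq> 0"
  using absv_y_less_1 large by auto

lemma degree_denom: "degree (denom a b n) = n * d \<and> monic (denom a b n)"
proof (induction n rule: induct_nat_012)
  case 0
  show ?case by (simp add: monic_def)
next
  case 1
  show ?case using monic_a by simp
next
  case (ge2 n)
  have nz: "a \<noteq> 0" "denom a b (Suc n) \<noteq> 0"
    using monic_a ge2 monic_nonzero by blast+
  have deg: "degree (a * denom a b (Suc n)) = Suc (Suc n) * d"
    using ge2 nz by (simp add: degree_mult_eq)
  have less: "degree (smult b (denom a b n)) < degree (a * denom a b (Suc n))"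
    unfolding deg using ge2 b_nonzero deg_pos by simp
  hence "degree (denom a b (Suc (Suc n))) = Suc (Suc n) * d"
    using deg by (simp add: degree_add_eq_left)
  moreover have "lead_coeff (denom a b (Suc (Suc n))) = lead_coeff (a * denom a b (Suc n))"
    using lead_coeff_add_le[OF less] by (simp only: denom.simps add.commute)
  moreover have "\<dots> = 1 * 1"
    unfolding lead_coeff_mult using ge2 monic_a unfolding monic_def by metis
  ultimately show ?case by (simp add: monic_def)
qed

text \<open>Binet's formula for the recurrence of the continuants.\<close>

lemma of_A_denom: "of_A (denom a b n) = (x ^ (n + 1) - y ^ (n + 1)) / (x - y)"
proof -
  have "(x - y) * of_A (denom a b n) = x ^ (n + 1) - y ^ (n + 1)"
  proof (induction n rule: induct_nat_012)
    case 1
    have "of_A a = x + y" by (simp add: y_def)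
    thus ?case by (simp add: algebra_simps power2_eq_square)
  next
    case (ge2 n)
    have a: "of_A a = x + y" and b: "fls_const b = - (x * y)" using xy by (simp_all add: y_def)
    have "(x - y) * of_A (denom a b (Suc (Suc n))) =
        (x + y) * ((x - y) * of_A (denom a b (Suc n))) - x * y * ((x - y) * of_A (denom a b n))"
      by (simp add: a b algebra_simps)
    thus ?case unfolding ge2 by (simp add: algebra_simps)
  qed simp
  thus ?thesis using x_neq_y by (simp add: field_simps)
qed

lemma of_A_combo:
  "of_A (combo a b N C) = (x ^ (N + 1) * ev x C - y ^ (N + 1) * ev y C) / (x - y)"
proof (induction C arbitrary: N)
  case (pCons c C)
  show ?case
    by (simp add: pCons.IH of_A_denom) (simp add: algebra_simps add_divide_distrib diff_divide_distrib)
qed simp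

text \<open>In Binet's formula the powers of x cancel in the difference, and only the small
  conjugate remains.\<close>

lemma combo_approximation:
  "of_A (combo a b N C) * x - of_A (combo a b (Suc N) C) = - (y ^ (N + 1) * ev y C)"
proof -
  define X Y where "X = x ^ (N + 1) * ev x C" and "Y = y ^ (N + 1) * ev y C"
  have "of_A (combo a b N C) * x - of_A (combo a b (Suc N) C)
      = (X - Y) / (x - y) * x - (x * X - y * Y) / (x - y)"
    by (simp add: of_A_combo X_def Y_def mult_ac)
  also have "\<dots> = ((X - Y) * x - (x * X - y * Y)) / (x - y)"
    by (simp add: diff_divide_distrib left_diff_distrib)
  also have "(X - Y) * x - (x * X - y * Y) = - Y * (x - y)" by (simp add: algebra_simps)
  also have "\<dots> / (x - y) = - Y" using x_neq_y by (rule nonzero_mult_div_cancel_right)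
  finally show ?thesis by (simp only: Y_def)
qed

lemma power_y_small: "absv (y ^ n) \<le> 1"
  using absv_y_less_1 by (simp add: power_le_one)

lemma dist_A_combo:
  assumes "has_digits d C"
  shows "dist_A (of_A (combo a b N C) * x) = absv y ^ (N + 1) * absv (ev y C)"
proof -
  have "absv (y ^ (N + 1) * ev y C) = absv (y ^ N) * absv (y * ev y C)" by simp
  also have "\<dots> \<le> 1 * absv (y * ev y C)"
    using power_y_small by (intro mult_right_mono) auto
  also have "\<dots> < 1" using absv_tail_small[OF assms absv_y] by simp
  finally have "absv (of_A (combo a b N C) * x - of_A (combo a b (Suc N) C)) < 1"
    unfolding combo_approximation by simp
  from dist_A_eqI[OF this] show ?thesis unfolding combo_approximation by simp
qed

text \<open>The continuants are monic of degree N d and digits have degree below d, so degrees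
  strictly increase from digit to digit.\<close>

lemma lead_coeff_combo:
  assumes "has_digits d C" "C \<noteq> 0"
  shows "combo a b N C \<noteq> 0 \<and> N * d \<le> degree (combo a b N C) \<and>
    lead_coeff (combo a b N C) = lead_coeff (lead_coeff C)"
  using assms
proof (induction C arbitrary: N)
  case (pCons c C)
  have den: "denom a b N \<noteq> 0" "degree (denom a b N) = N * d" "lead_coeff (denom a b N) = 1"
    using degree_denom[of N] monic_nonzero by (auto simp: monic_def)
  show ?case
  proof (cases "C = 0")
    case True
    hence "c \<noteq> 0" using pCons by simp
    hence "c * denom a b N \<noteq> 0" "N * d \<le> degree (c * denom a b N)"
      using den by (simp_all add: degree_mult_eq)
    moreover have "lead_coeff (c * denom a b N) = lead_coeff c"
      by (simp only: lead_coeff_mult den(3) mult_1_right)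
    ultimately show ?thesis using True by simp
  next
    case False
    have "has_digits d C" using pCons.prems by simp
    note IH = pCons.IH[OF this False, of "Suc N"]
    have "degree (c * denom a b N) \<le> degree c + N * d"
      using degree_mult_le[of c "denom a b N"] den by simp
    also have "\<dots> < Suc N * d" using pCons.prems by simp
    finally have less: "degree (c * denom a b N) < degree (combo a b (Suc N) C)" using IH by simp
    have "degree (combo a b N (pCons c C)) = degree (combo a b (Suc N) C)"
      using less by (simp add: degree_add_eq_right)
    moreover have "lead_coeff (combo a b N (pCons c C)) = lead_coeff (combo a b (Suc N) C)"
      unfolding combo_pCons by (rule lead_coeff_add_le[OF less])
    moreover have "0 < degree (combo a b (Suc N) C)" "N * d \<le> Suc N * d"
      using IH deg_pos by auto
    ultimately show ?thesis using IH False by (metis degree_0 lead_coeff_pCons(1) less_irrefl order.trans)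
  qed
qed simp

lemma combo_inject:
  assumes "has_digits d C" "has_digits d D" "combo a b N C = combo a b N D"
  shows "C = D"
proof (rule ccontr)
  assume "C \<noteq> D"
  have "combo a b N C = combo a b N (C - D) + combo a b N D"
    by (simp flip: combo_add)
  hence "combo a b N (C - D) = 0" using assms(3) by simp
  thus False
    using lead_coeff_combo[OF has_digits_diff[OF assms(1,2)], of N] \<open>C \<noteq> D\<close> by simp
qed

text \<open>The top digit is the quotient by a continuant, and the remainder has an expansion
  with one digit fewer.\<close>

lemma combo_surj:
  "p \<in> polys_below (m * d) \<Longrightarrow>
    \<exists>C. has_digits d C \<and> (\<forall>i\<ge>m. coeff C i = 0) \<and> p = combo a b 0 C"
proof (induction m arbitrary: p)
  case 0
  thus ?case using deg_pos by (intro exI[of _ 0]) simp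
next
  case (Suc m)
  define r s where "r = p mod denom a b m" and "s = p div denom a b m"
  have den: "denom a b m \<noteq> 0" "degree (denom a b m) = m * d"
    using degree_denom[of m] monic_nonzero by auto
  have "r = 0 \<or> degree r < m * d"
    unfolding r_def den(2)[symmetric] using den(1) by (rule degree_mod_less)
  hence "r \<in> polys_below (m * d)"
    by (auto simp: polys_below_def coeff_eq_0)
  from Suc.IH[OF this] obtain C where C:
    "has_digits d C" "\<forall>i\<ge>m. coeff C i = 0" "r = combo a b 0 C" by blast
  have "degree p < Suc m * d" using Suc.prems deg_pos by (intro polys_below_degree) auto
  have s: "degree s < d"
  proof (rule ccontr)
    assume "\<not> degree s < d"
    moreover from this have "s \<noteq> 0" using deg_pos by auto
    ultimately have "Suc m * d \<le> degree (s * denom a b m)" "0 < degree (s * denom a b m)"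
      using den deg_pos by (auto simp: degree_mult_eq)
    moreover have "degree r < degree (s * denom a b m)"
      using \<open>r = 0 \<or> degree r < m * d\<close> calculation by auto
    hence "degree (s * denom a b m + r) = degree (s * denom a b m)" by (rule degree_add_eq_left)
    ultimately show False using \<open>degree p < Suc m * d\<close> by (simp add: s_def r_def)
  qed
  \<comment> \<open>The digit s is placed at position m, where C has none.\<close>
  have "p = combo a b 0 (C + monom s m)"
    by (simp add: combo_add combo_monom C(3)[symmetric] r_def s_def)
  moreover have "has_digits d (C + monom s m)"
    unfolding has_digits_def
  proof
    fix i
    show "degree (coeff (C + monom s m) i) < d"
      using C(1,2) s by (cases "i = m") (auto simp: has_digits_def)
  qed
  moreover have "\<forall>i\<ge>Suc m. coeff (C + monom s m) i = 0" using C(2) by simp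
  ultimately show ?case by blast
qed

text \<open>If the lowest digit does not vanish then |ev y C| is at least 1. So as long as the
  error is below 1 the lowest digit is 0, and dropping it multiplies the error by q^d.\<close>

lemma small_combo_shift:
  assumes "has_digits d C" "absv (ev y C) * real CARD('a) ^ (N * d) < real CARD('a) ^ Suc D" "D < d"
  shows "\<exists>C'. has_digits d C' \<and> degree (coeff C' 0) \<le> D \<and>
    (\<forall>K. combo a b K C = combo a b (K + N) C')"
  using assms(1,2)
proof (induction N arbitrary: C)
  case 0
  obtain c C1 where C: "C = pCons c C1" by (rule pCons_cases)
  have "degree c \<le> D"
  proof (cases "c = 0")
    case False
    hence "real CARD('a) ^ degree c < real CARD('a) ^ Suc D"
      using 0 absv_ev_small[of d c C1 y] absv_y by (simp add: C)
    hence "degree c < Suc D" by (rule power_less_imp_less_exp[rotated]) simp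
    thus ?thesis by simp
  qed simp
  thus ?case using 0 by (intro exI[of _ C]) (simp add: C)
next
  case (Suc N)
  obtain c C1 where C: "C = pCons c C1" by (rule pCons_cases)
  have "real CARD('a) ^ Suc D \<le> real CARD('a) ^ (Suc N * d)"
    using \<open>D < d\<close> by (intro power_increasing) auto
  with Suc.prems(2) have "absv (ev y C) * real CARD('a) ^ (Suc N * d) < 1 * real CARD('a) ^ (Suc N * d)" by linarith
  hence less: "absv (ev y C) < 1" by (rule mult_right_less_imp_less) simp
  have c: "c = 0"
  proof (rule ccontr)
    assume "c \<noteq> 0"
    hence "absv (ev y C) \<ge> 1"
      using Suc.prems(1) absv_ev_small[of d c C1 y] absv_y by (simp add: C)
    thus False using less by simp
  qed
  have "absv (ev y C) * real CARD('a) ^ (Suc N * d) = absv (ev y C1) * real CARD('a) ^ (N * d) * (absv y * real CARD('a) ^ d)"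
    by (simp add: C c power_add)
  also have "\<dots> = absv (ev y C1) * real CARD('a) ^ (N * d)" unfolding absv_y by simp
  finally have "absv (ev y C1) * real CARD('a) ^ (N * d) < real CARD('a) ^ Suc D" using Suc.prems(2) by simp
  then obtain C' where "has_digits d C'" "degree (coeff C' 0) \<le> D"
    "\<forall>K. combo a b K C1 = combo a b (K + N) C'"
    using Suc.IH[of C1] Suc.prems(1) by (auto simp: C)
  thus ?case by (intro exI[of _ C']) (simp add: C c)
qed

text \<open>The error of an expansion that starts at index N with a lowest digit of degree
  \<delta> is q^(\<delta> - (N+1)d). The two bounds on \<epsilon> separate \<delta> = D from
  \<delta> = D + 1.\<close>

lemma bij_betw_combo:
  assumes "D < d" "real CARD('a) ^ D / real CARD('a) ^ ((N + 1) * d) < \<epsilon>" "\<epsilon> \<le> real CARD('a) ^ Suc D / real CARD('a) ^ ((N + 1) * d)"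
  shows "bij_betw (combo a b N) (expansions d D) (Lam_mon x \<epsilon>)"
  unfolding bij_betw_def
proof (intro conjI inj_onI equalityI subsetI)
  fix C C' assume "C \<in> expansions d D" "C' \<in> expansions d D" "combo a b N C = combo a b N C'"
  thus "C = C'" using combo_inject[of C C' N] by (simp add: expansions_def)
next
  have y: "absv y ^ (N + 1) = 1 / real CARD('a) ^ ((N + 1) * d)"
  proof -
    have "absv y = 1 / real CARD('a) ^ d" using absv_y by (simp add: field_simps)
    thus ?thesis by (simp only: power_divide power_one power_mult[symmetric] mult.commute)
  qed
  fix p
  show "p \<in> Lam_mon x \<epsilon>" if p: "p \<in> combo a b N ` expansions d D"
  proof -
    obtain C where C: "p = combo a b N C" "monic (lead_coeff C)" "has_digits d C" "degree (coeff C 0) \<le> D"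
      using p by (auto simp: expansions_def)
    obtain c C1 where CC: "C = pCons c C1" by (rule pCons_cases)
    have "absv (of_A c) \<le> real CARD('a) ^ D" using C by (intro absv_of_A_le) (simp add: CC)
    moreover have "absv (y * ev y C1) \<le> real CARD('a) ^ D"
    proof -
      have "absv (y * ev y C1) \<le> 1" using absv_tail_small[of d C1 y] C(3) absv_y by (simp add: CC)
      also have "\<dots> \<le> real CARD('a) ^ D" by (intro one_le_power) simp
      finally show ?thesis .
    qed
    ultimately have "absv (ev y C) \<le> real CARD('a) ^ D" unfolding CC ev_pCons by (rule absv_add_leI)
    hence "absv y ^ (N + 1) * absv (ev y C) \<le> absv y ^ (N + 1) * real CARD('a) ^ D"
      by (intro mult_left_mono) simp_all
    also have "\<dots> < \<epsilon>" unfolding y using assms(2) by simp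
    finally have "dist_A (of_A p * x) < \<epsilon>" unfolding C(1) dist_A_combo[OF C(3)] .
    moreover have "monic p"
      using lead_coeff_combo[OF C(3), of N] C monic_nonzero[OF C(2)] by (auto simp: monic_def)
    ultimately show ?thesis by (simp add: Lam_mon_def Lam_def)
  qed
  show "p \<in> combo a b N ` expansions d D" if p: "p \<in> Lam_mon x \<epsilon>"
  proof -
    have "p \<in> polys_below (Suc (degree p) * d)"
      using deg_pos by (intro degree_polys_below) (cases d; simp)
    then obtain C where C: "has_digits d C" "p = combo a b 0 C" using combo_surj by blast
    have "dist_A (of_A p * x) < \<epsilon>" using p by (simp add: Lam_mon_def Lam_def)
    hence "absv y * absv (ev y C) < real CARD('a) ^ Suc D / real CARD('a) ^ ((N + 1) * d)"
      using assms(3) dist_A_combo[OF C(1), of 0] by (simp add: C(2))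
    hence "absv y * absv (ev y C) * real CARD('a) ^ ((N + 1) * d) < real CARD('a) ^ Suc D"
      by (simp add: pos_less_divide_eq)
    moreover have "absv y * absv (ev y C) * real CARD('a) ^ ((N + 1) * d) = absv (ev y C) * real CARD('a) ^ (N * d) * (absv y * real CARD('a) ^ d)"
    proof -
      have "(N + 1) * d = N * d + d" by simp
      thus ?thesis by (simp only: power_add mult_ac)
    qed
    ultimately have "absv (ev y C) * real CARD('a) ^ (N * d) < real CARD('a) ^ Suc D"
      by (simp only: absv_y mult_1_right)
    from small_combo_shift[OF C(1) this assms(1)] obtain C' where C':
      "has_digits d C'" "degree (coeff C' 0) \<le> D" "\<And>K. combo a b K C = combo a b (K + N) C'" by blast
    have p': "p = combo a b N C'" using C(2) C'(3)[of 0] by simp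
    have monic: "monic p" using p by (simp add: Lam_mon_def)
    hence "C' \<noteq> 0" using p' monic_nonzero[OF monic] by auto
    hence "monic (lead_coeff C')"
      using lead_coeff_combo[OF C'(1), of N] monic p' by (simp add: monic_def)
    thus ?thesis using C' p' by (auto simp: expansions_def)
  qed
qed

text \<open>The part of a combination that comes from the conjugate root, after division by
  x^(N+1) / (x - y).\<close>

definition correction :: "nat \<Rightarrow> 'a poly poly \<Rightarrow> 'a fls" where
  "correction N C = (y / x) ^ (N + 1) * ev y C"

lemma absv_correction: "has_digits d C \<Longrightarrow> absv (correction N C) \<le> 1 / real CARD('a) ^ (N + 1)"
proof -
  assume C: "has_digits d C"
  have y: "absv y = 1 / real CARD('a) ^ d" using absv_y by (simp add: field_simps)
  have yx: "absv (y / x) = 1 / real CARD('a) ^ (2 * d)"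
    unfolding absv_divide y absv_x by (simp add: mult_2 power_add)
  have "absv (correction N C) = absv (y / x) ^ (N + 1) * absv (ev y C)"
    by (simp only: correction_def absv_mult absv_power)
  also have "\<dots> = absv (ev y C) / real CARD('a) ^ (2 * d * (N + 1))"
    unfolding yx by (simp only: power_divide power_one power_mult[symmetric]) simp
  also have "\<dots> \<le> real CARD('a) ^ (d - 1) / real CARD('a) ^ (2 * d * (N + 1))"
    using absv_ev_small_le[OF C, of y] absv_y_less_1 by (intro divide_right_mono) auto
  also have "\<dots> \<le> 1 / real CARD('a) ^ (N + 1)"
  proof -
    have "N \<le> d * N" using deg_pos by (cases d) auto
    moreover have "2 * d * (N + 1) = 2 * (d * N) + 2 * d" by (simp add: algebra_simps)
    ultimately have "(d - 1) + (N + 1) \<le> 2 * d * (N + 1)" using deg_pos by linarith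
    hence "real CARD('a) ^ (d - 1) * real CARD('a) ^ (N + 1) \<le> real CARD('a) ^ (2 * d * (N + 1))"
      unfolding power_add[symmetric] by (intro power_increasing) auto
    thus ?thesis by (simp only: divide_simps) simp
  qed
  finally show ?thesis .
qed

definition corrected_zeta :: "nat \<Rightarrow> nat \<Rightarrow> nat \<Rightarrow> 'a fls" where
  "corrected_zeta D N n = (\<Sum>\<^sub>\<infinity>C\<in>expansions d D. 1 / (ev x C - correction N C) ^ n)"

lemma correction_small:
  assumes "C \<in> expansions d D"
  shows "absv (correction N C) < absv (ev x C)"
proof -
  have "absv (correction N C) \<le> 1 / real CARD('a) ^ (N + 1)"
    using assms by (intro absv_correction) (simp add: expansions_def)
  also have "\<dots> < 1" using one_less_power[of "real CARD('a)" "N + 1"] by simp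
  also have "\<dots> \<le> absv (ev x C)" using absv_ev_expansions(2)[OF assms absv_x] .
  finally show ?thesis .
qed

lemma corrected_zeta_summable:
  assumes "n > 0"
  shows "(\<lambda>C. 1 / (ev x C - correction N C) ^ n) summable_on expansions d D"
  using assms deg_pos absv_x correction_small
  by (intro summable_expansions[where x = x] absv_diff_dominant)

lemma corrected_zeta_close:
  assumes "n > 0"
  shows "absv (corrected_zeta D N n - full_zeta d D x n) \<le> 1 / real CARD('a) ^ (N + 1)"
proof (rule has_sum_diff_absv_le)
  show "((\<lambda>C. 1 / (ev x C - correction N C) ^ n) has_sum corrected_zeta D N n) (expansions d D)"
    unfolding corrected_zeta_def using corrected_zeta_summable[OF assms] by (rule has_sum_infsum)
  show "((\<lambda>C. 1 / ev x C ^ n) has_sum full_zeta d D x n) (expansions d D)"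
    by (intro has_sum_full_zeta deg_pos assms absv_x)
  fix C :: "'a poly poly" assume C: "C \<in> expansions d D"
  have le: "absv (correction N C) \<le> 1 / real CARD('a) ^ (N + 1)"
    using C by (intro absv_correction) (simp add: expansions_def)
  also have "\<dots> < 1" using one_less_power[of "real CARD('a)" "N + 1"] by simp
  finally have "absv ((ev x C - correction N C) - ev x C) < 1" by simp
  with absv_ev_expansions(2)[OF C absv_x]
  have "absv (1 / (ev x C - correction N C) ^ n - 1 / ev x C ^ n) \<le> absv ((ev x C - correction N C) - ev x C)"
    by (rule absv_inverse_power_diff)
  thus "absv (1 / (ev x C - correction N C) ^ n - 1 / ev x C ^ n) \<le> 1 / real CARD('a) ^ (N + 1)"
    using le by simp
qed simp

text \<open>The factor does not depend on the expansion, and it is raised to the same total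
  power in numerator and denominator of the quantum invariant.\<close>

lemma zeta_eq_corrected_zeta:
  assumes "D < d" "real CARD('a) ^ D / real CARD('a) ^ ((N + 1) * d) < \<epsilon>" "\<epsilon> \<le> real CARD('a) ^ Suc D / real CARD('a) ^ ((N + 1) * d)" "n > 0"
  shows "zeta x \<epsilon> n = ((x - y) / x ^ (N + 1)) ^ n * corrected_zeta D N n"
proof -
  have "zeta x \<epsilon> n = (\<Sum>\<^sub>\<infinity>C\<in>expansions d D. 1 / of_A (combo a b N C) ^ n)"
    unfolding zeta_def by (rule infsum_reindex_bij_betw[OF bij_betw_combo[OF assms(1-3)], symmetric])
  also have "\<dots> = (\<Sum>\<^sub>\<infinity>C\<in>expansions d D.
      ((x - y) / x ^ (N + 1)) ^ n * (1 / (ev x C - correction N C) ^ n))"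
  proof (rule infsum_cong)
    fix C
    have "x ^ (N + 1) * ev x C - y ^ (N + 1) * ev y C = (ev x C - correction N C) * x ^ (N + 1)"
      using x_nonzero by (simp add: correction_def power_divide left_diff_distrib)
    hence "of_A (combo a b N C) = (ev x C - correction N C) / ((x - y) / x ^ (N + 1))"
      by (simp only: of_A_combo divide_divide_eq_right)
    moreover have "1 / (u / s) ^ n = s ^ n * (1 / u ^ n)" for u s :: "'a fls"
      by (simp add: power_divide)
    ultimately show "1 / of_A (combo a b N C) ^ n =
        ((x - y) / x ^ (N + 1)) ^ n * (1 / (ev x C - correction N C) ^ n)"
      by (simp only:)
  qed
  also have "\<dots> = ((x - y) / x ^ (N + 1)) ^ n * corrected_zeta D N n"
    unfolding corrected_zeta_def
    by (intro infsumI has_sum_fls_cmult has_sum_infsum corrected_zeta_summable assms)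
  finally show ?thesis .
qed

text \<open>The factor s cancels because (q-1)(q+1) = q^2-1. All quantities that remain have
  absolute value at most 1 and the denominators have absolute value 1, so no precision is lost in
  the quotient.\<close>

lemma J_tilde_eps_close:
  assumes "D < d" "real CARD('a) ^ D / real CARD('a) ^ ((N + 1) * d) < \<epsilon>" "\<epsilon> \<le> real CARD('a) ^ Suc D / real CARD('a) ^ ((N + 1) * d)"
  shows "absv (J_tilde_eps x \<epsilon> - zeta_ratio d D x) \<le> 1 / real CARD('a) ^ (N + 1)"
proof -
  let ?q = "CARD('a)"
  note pos = card_field_exponents_pos[where 'a='a]
  define M M' B B' where "M = full_zeta d D x (?q - 1)" and "M' = corrected_zeta D N (?q - 1)"
    and "B = full_zeta d D x (?q\<^sup>2 - 1)" and "B' = corrected_zeta D N (?q\<^sup>2 - 1)"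
  define s where "s = (x - y) / x ^ (N + 1)"
  have s: "s \<noteq> 0" using x_neq_y x_nonzero by (simp add: s_def)
  have lt: "1 / real CARD('a) ^ (N + 1) < 1" using one_less_power[of "real CARD('a)" "N + 1"] by simp
  have close: "absv (M' - M) \<le> 1 / real CARD('a) ^ (N + 1)" "absv (B' - B) \<le> 1 / real CARD('a) ^ (N + 1)"
    using corrected_zeta_close[OF pos(1)] corrected_zeta_close[OF pos(2)]
    by (simp_all only: M_def M'_def B_def B'_def)
  have 1: "absv M = 1" "absv B = 1"
    using absv_full_zeta[OF deg_pos pos(1) absv_x] absv_full_zeta[OF deg_pos pos(2) absv_x]
    by (simp_all only: M_def B_def)
  have "absv (M' - M) < absv M" unfolding 1 using close(1) lt by linarith
  hence M': "absv M' = 1" using absv_eq_of_close[of M' M] 1 by simp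
  have exps: "(?q - 1) * (?q + 1) = ?q\<^sup>2 - 1"
    by (simp add: power2_eq_square algebra_simps)
  have "J_tilde_eps x \<epsilon> = (s ^ (?q\<^sup>2 - 1) * B') / (s ^ (?q - 1) * M') ^ (?q + 1)"
    unfolding J_tilde_eps_def Let_def
    by (simp only: zeta_eq_corrected_zeta[OF assms pos(1)] zeta_eq_corrected_zeta[OF assms pos(2)]
        s_def M'_def B'_def)
  also have "(s ^ (?q - 1) * M') ^ (?q + 1) = s ^ (?q\<^sup>2 - 1) * M' ^ (?q + 1)"
    by (simp only: power_mult_distrib power_mult[symmetric] exps)
  also have "(s ^ (?q\<^sup>2 - 1) * B') / (s ^ (?q\<^sup>2 - 1) * M' ^ (?q + 1)) = B' * (1 / M' ^ (?q + 1))"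
    using s by simp
  finally have "J_tilde_eps x \<epsilon> - zeta_ratio d D x =
      (B' - B) * (1 / M' ^ (?q + 1)) + B * (1 / M' ^ (?q + 1) - 1 / M ^ (?q + 1))"
    by (simp add: zeta_ratio_def M_def B_def algebra_simps)
  moreover have "absv ((B' - B) * (1 / M' ^ (?q + 1))) \<le> 1 / real CARD('a) ^ (N + 1)"
    unfolding absv_mult absv_divide absv_power M' using close by simp
  moreover have "absv (1 / M' ^ (?q + 1) - 1 / M ^ (?q + 1)) \<le> absv (M' - M)"
    using 1 close lt by (intro absv_inverse_power_diff) linarith+
  hence "absv (B * (1 / M' ^ (?q + 1) - 1 / M ^ (?q + 1))) \<le> 1 / real CARD('a) ^ (N + 1)"
    unfolding absv_mult 1 using close by simp
  ultimately show ?thesis by (simp only: absv_add_leI)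
qed

end

section \<open>Splitting the sum over expansions\<close>

definition expansion_lists :: "nat \<Rightarrow> nat \<Rightarrow> 'a::{finite,field} poly list set" where
  "expansion_lists d D = {cs. cs \<noteq> [] \<and> monic (last cs) \<and> (\<forall>c\<in>set cs. degree c < d) \<and> degree (hd cs) \<le> D}"

lemma expansion_lists_coeffs_Poly: "cs \<in> expansion_lists d D \<Longrightarrow> coeffs (Poly cs) = cs"
  using monic_nonzero[of "last cs"] by (auto simp: expansion_lists_def no_trailing_unfold)

lemma bij_betw_Poly_expansions:
  assumes "d > 0"
  shows "bij_betw Poly (expansion_lists d D :: 'a::{finite,field} poly list set) (expansions d D)"
proof (rule bij_betw_byWitness[of _ coeffs])
  let ?L = "expansion_lists d D :: 'a poly list set" and ?E = "expansions d D :: 'a poly poly set"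
  show "\<forall>cs\<in>?L. coeffs (Poly cs) = cs"
    by (intro ballI expansion_lists_coeffs_Poly)
  show "\<forall>C\<in>?E. Poly (coeffs C) = C" by simp
  show "Poly ` ?L \<subseteq> ?E"
  proof (rule image_subsetI)
    fix cs :: "'a poly list" assume cs: "cs \<in> expansion_lists d D"
    note co = expansion_lists_coeffs_Poly[OF cs]
    have nz: "Poly cs \<noteq> 0"
      using cs co by (auto simp: expansion_lists_def simp del: coeffs_Poly)
    have "lead_coeff (Poly cs) = last cs"
      using co last_coeffs_eq_coeff_degree[OF nz] by (simp del: coeffs_Poly)
    moreover have "coeff (Poly cs) 0 = hd cs"
      using cs by (cases cs) (auto simp: expansion_lists_def)
    moreover have "has_digits d (Poly cs)"
      using cs assms by (auto simp: has_digits_def expansion_lists_def nth_default_def)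
    ultimately show "Poly cs \<in> expansions d D"
      using cs by (simp add: expansions_def expansion_lists_def)
  qed
  show "coeffs ` ?E \<subseteq> ?L"
  proof (rule image_subsetI)
    fix C :: "'a poly poly" assume C: "C \<in> expansions d D"
    have nz: "C \<noteq> 0" using C by (rule expansions_nonzero)
    have "hd (coeffs C) = coeff C 0" using nz by (cases C rule: pCons_cases) (auto simp: cCons_def)
    thus "coeffs C \<in> expansion_lists d D"
      using C nz last_coeffs_eq_coeff_degree[OF nz]
      by (auto simp: expansion_lists_def expansions_def has_digits_def coeffs_def)
  qed
qed

text \<open>The tuples of the sums H_l are lists of digits with the lowest digit first; those of
  H enter with an additional lowest digit 0.\<close>

definition tuple_value :: "'a::{finite,field} fls \<Rightarrow> 'a poly list \<Rightarrow> 'a fls" where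
  "tuple_value x cs = (\<Sum>i<length cs. of_A (cs ! i) * x ^ i)"

lemma tuple_value_ev: "tuple_value x cs = ev x (Poly cs)"
  by (simp add: tuple_value_def ev_Poly)

lemma has_sum_expansion_lists:
  fixes x :: "'a::{finite,field} fls"
  assumes "d > 0" "n > 0" "absv x = real CARD('a) ^ d"
  shows "((\<lambda>cs. 1 / tuple_value x cs ^ n) has_sum full_zeta d D x n) (expansion_lists d D)"
proof -
  have bij: "inj_on Poly (expansion_lists d D :: 'a poly list set)"
    "Poly ` expansion_lists d D = (expansions d D :: 'a poly poly set)"
    using bij_betw_Poly_expansions[OF assms(1), where 'a='a] by (auto simp: bij_betw_def)
  have "((\<lambda>C. 1 / ev x C ^ n) \<circ> Poly has_sum full_zeta d D x n) (expansion_lists d D)"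
    using has_sum_full_zeta[OF assms, of D] has_sum_reindex[OF bij(1)] unfolding bij(2) by blast
  thus ?thesis by (simp add: o_def tuple_value_ev)
qed

text \<open>The tuples whose value is T^j x^m with m > 0. They are excluded from the sum in H,
  which accounts for them by a closed expression.\<close>

definition pure_tuples :: "nat \<Rightarrow> 'a::{finite,field} poly list set" where
  "pure_tuples d = {replicate (Suc m) 0 @ [monom 1 j] | m j. j < d}"

text \<open>Multiplication by x maps the family into itself and misses only the values T^j
  x.\<close>

lemma pure_tuples_unfold:
  "(pure_tuples d :: 'a::{finite,field} poly list set) =
    (\<lambda>j. [0, monom 1 j]) ` {..<d} \<union> Cons 0 ` pure_tuples d"
proof (intro equalityI subsetI)
  fix cs :: "'a poly list" assume "cs \<in> pure_tuples d"
  then obtain m j where cs: "cs = replicate (Suc m) 0 @ [monom 1 j]" "j < d"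
    by (auto simp: pure_tuples_def)
  show "cs \<in> (\<lambda>j. [0, monom 1 j]) ` {..<d} \<union> Cons 0 ` pure_tuples d"
  proof (cases m)
    case (Suc k)
    hence "cs = 0 # (replicate (Suc k) 0 @ [monom 1 j])" using cs by simp
    moreover have "replicate (Suc k) 0 @ [monom 1 j] \<in> pure_tuples d"
      using cs by (auto simp: pure_tuples_def)
    ultimately show ?thesis by blast
  qed (use cs in auto)
next
  fix cs :: "'a poly list"
  assume "cs \<in> (\<lambda>j. [0, monom 1 j]) ` {..<d} \<union> Cons 0 ` pure_tuples d"
  thus "cs \<in> pure_tuples d"
  proof
    assume "cs \<in> (\<lambda>j. [0, monom 1 j]) ` {..<d}"
    then obtain j where "cs = replicate (Suc 0) 0 @ [monom 1 j]" "j < d" by auto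
    thus ?thesis unfolding pure_tuples_def by blast
  next
    assume "cs \<in> Cons 0 ` pure_tuples d"
    then obtain m j where "cs = replicate (Suc (Suc m)) 0 @ [monom 1 j]" "j < d"
      by (auto simp: pure_tuples_def)
    thus ?thesis unfolding pure_tuples_def by blast
  qed
qed

lemma tuple_value_Cons: "tuple_value x (c # cs) = of_A c + x * tuple_value x cs"
  by (simp add: tuple_value_ev)

lemma monic_monom [simp]: "monic (monom 1 j)"
  by (simp add: monic_def degree_monom_eq)

text \<open>The unfolding gives s = zeta_T / x^n + s / x^n for the sum s, so the geometric
  series is summed by solving a linear equation.\<close>

lemma has_sum_pure_tuples:
  fixes x :: "'a::{finite,field} fls"
  assumes "d > 0" "n > 0" "absv x > 1"
    and summable: "(\<lambda>cs. 1 / tuple_value x cs ^ n) summable_on pure_tuples d"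
  shows "((\<lambda>cs. 1 / tuple_value x cs ^ n) has_sum (zeta_T d 0 n / (x ^ n - 1))) (pure_tuples d)"
proof -
  define g where "g = (\<lambda>cs. 1 / tuple_value x cs ^ n)"
  obtain s where s: "(g has_sum s) (pure_tuples d)" using summable by (auto simp: summable_on_def g_def)
  have d: "{..<d} = {..d - 1 - 0}" using assms(1) by auto
  have x: "x \<noteq> 0" using assms(3) by auto
  have "(g has_sum (\<Sum>cs\<in>(\<lambda>j. [0, monom 1 j]) ` {..<d}. g cs)) ((\<lambda>j. [0, monom 1 j]) ` {..<d})"
    by (intro has_sum_finite) simp
  also have "(\<Sum>cs\<in>(\<lambda>j. [0, monom 1 j]) ` {..<d}. g cs) = (\<Sum>j<d. g [0, monom 1 j])"
    by (subst sum.reindex) (auto simp: inj_on_def monom_eq_iff')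
  also have "\<dots> = zeta_T d 0 n / x ^ n"
    unfolding zeta_T_def sum_divide_distrib d
    by (intro sum.cong)
       (auto simp: g_def tuple_value_def of_A_monom power_mult_distrib mult_ac simp flip: power_mult)
  finally have 1: "(g has_sum (zeta_T d 0 n / x ^ n)) ((\<lambda>j. [0, monom 1 j]) ` {..<d})" .
  have "((\<lambda>cs. 1 / x ^ n * g cs) has_sum (1 / x ^ n * s)) (pure_tuples d)"
    by (rule has_sum_fls_cmult) fact
  also have "(\<lambda>cs. 1 / x ^ n * g cs) = g \<circ> Cons 0"
    by (simp add: fun_eq_iff g_def tuple_value_Cons power_mult_distrib)
  finally have 2: "(g has_sum (1 / x ^ n * s)) (Cons 0 ` pure_tuples d)"
    by (subst has_sum_reindex) (simp_all only: inj_on_def list.inject simp_thms, blast?)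
  have "(g has_sum (zeta_T d 0 n / x ^ n + 1 / x ^ n * s)) (pure_tuples d)"
    by (subst pure_tuples_unfold, rule has_sum_Un_disjoint[OF 1 2])
       (auto simp: pure_tuples_def monom_eq_0_iff Cons_eq_append_conv)
  hence "s = zeta_T d 0 n / x ^ n + 1 / x ^ n * s" using s has_sum_unique by blast
  hence "s * x ^ n = zeta_T d 0 n + s" using x by (simp add: field_simps)
  moreover have "absv (x ^ n) > 1" using assms(2,3) by (simp add: one_less_power)
  hence "x ^ n \<noteq> 1" by (intro notI) (simp only: absv_1)
  hence "x ^ n - 1 \<noteq> 0" by simp
  ultimately have "s = zeta_T d 0 n / (x ^ n - 1)" by (simp add: field_simps)
  thus ?thesis using s by (simp add: g_def)
qed

text \<open>The four parts are the four ingredients of H_l + H: the lowest digit is nonzero in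
  the first two and zero in the last two, and in each pair the first part consists of the tuples
  with value T^j x^m.\<close>

lemma expansion_lists_decompose:
  assumes "d > 0"
  shows "(expansion_lists d (d - 1 - l) :: 'a::{finite,field} poly list set) =
    (\<lambda>j. [monom 1 j]) ` {..d - 1 - l} \<union> (tuples_Hl d l \<union> (pure_tuples d \<union> Cons 0 ` tuples_H d))"
proof (intro equalityI subsetI)
  fix cs :: "'a poly list" assume "cs \<in> expansion_lists d (d - 1 - l)"
  hence cs: "cs \<noteq> []" "monic (last cs)" "\<And>c. c \<in> set cs \<Longrightarrow> degree c \<le> d - 1" "degree (hd cs) \<le> d - 1 - l"
    by (auto simp: expansion_lists_def)
  then obtain c ds where C: "cs = c # ds" by (cases cs) auto
  consider j where "j \<le> d - 1" "cs = [monom 1 j]" | "c \<noteq> 0" "\<not> (\<exists>j\<le>d - 1. cs = [monom 1 j])" | "c = 0"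
    by auto
  thus "cs \<in> (\<lambda>j. [monom 1 j]) ` {..d - 1 - l} \<union> (tuples_Hl d l \<union> (pure_tuples d \<union> Cons 0 ` tuples_H d))"
  proof cases
    case 1
    thus ?thesis using cs(4) by (auto simp: degree_monom_eq)
  next
    case 2
    hence "cs \<in> tuples_Hl d l" using cs by (auto simp: tuples_Hl_def C)
    thus ?thesis by blast
  next
    case 3
    have ds: "ds \<noteq> []" using cs(2) 3 by (auto simp: C monic_def)
    show ?thesis
    proof (cases "(\<forall>e\<in>set (butlast ds). e = 0) \<and> (\<exists>j\<le>d - 1. last ds = monom 1 j)")
      case True
      then obtain j where j: "j \<le> d - 1" "last ds = monom 1 j" by blast
      define k where "k = length (butlast ds)"
      have "butlast ds = replicate k 0" using True by (intro replicate_eqI) (auto simp: k_def)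
      hence "ds = replicate k 0 @ [monom 1 j]" using append_butlast_last_id[OF ds] j by simp
      hence "cs = replicate (Suc k) 0 @ [monom 1 j]" by (simp add: C 3)
      thus ?thesis using j assms unfolding pure_tuples_def by fastforce
    next
      case False
      hence "ds \<in> tuples_H d" using cs ds 3 unfolding tuples_H_def by (auto simp: C)
      thus ?thesis using 3 by (simp add: C)
    qed
  qed
next
  fix cs :: "'a poly list"
  have less: "degree c < d" if "degree c \<le> d - 1" for c :: "'a poly"
    using that assms by linarith
  assume "cs \<in> (\<lambda>j. [monom 1 j]) ` {..d - 1 - l} \<union> (tuples_Hl d l \<union> (pure_tuples d \<union> Cons 0 ` tuples_H d))"
  then consider j where "j \<le> d - 1 - l" "cs = [monom 1 j]" | "cs \<in> tuples_Hl d l"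
    | m j where "j < d" "cs = replicate (Suc m) 0 @ [monom 1 j]" | ds where "ds \<in> tuples_H d" "cs = 0 # ds"
    by (auto simp: pure_tuples_def)
  thus "cs \<in> expansion_lists d (d - 1 - l)"
  proof cases
    case 1
    thus ?thesis using assms by (simp add: expansion_lists_def degree_monom_eq)
  next
    case 2
    thus ?thesis by (simp add: expansion_lists_def tuples_Hl_def less)
  next
    case 3
    thus ?thesis by (auto simp: expansion_lists_def degree_monom_eq)
  next
    case 4
    thus ?thesis using assms by (simp add: expansion_lists_def tuples_H_def less)
  qed
qed

lemma H_l_plus_H:
  fixes x :: "'a::{finite,field} fls"
  assumes "d > 0" "n > 0" "absv x = real CARD('a) ^ d"
  shows "H_l d x l n + H d x n = full_zeta d (d - 1 - l) x n"
proof -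
  define g where "g = (\<lambda>cs. 1 / tuple_value x cs ^ n)"
  have L: "(g has_sum full_zeta d (d - 1 - l) x n) (expansion_lists d (d - 1 - l))"
    unfolding g_def by (rule has_sum_expansion_lists[OF assms])
  define A1 A2 A3 A4 :: "'a poly list set" where "A1 = (\<lambda>j. [monom 1 j]) ` {..d - 1 - l}"
    and "A2 = tuples_Hl d l" and "A3 = pure_tuples d" and "A4 = Cons 0 ` tuples_H d"
  have dec: "expansion_lists d (d - 1 - l) = A1 \<union> (A2 \<union> (A3 \<union> A4))"
    unfolding A1_def A2_def A3_def A4_def by (rule expansion_lists_decompose) fact
  have summable: "g summable_on A" if "A \<subseteq> A1 \<union> (A2 \<union> (A3 \<union> A4))" for A
    by (rule summable_on_fls_subset[OF _ that]) (use L dec in \<open>auto simp: summable_on_def\<close>)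
  have hd: "cs \<in> A1 \<union> A2 \<Longrightarrow> hd cs \<noteq> 0" "cs \<in> A3 \<union> A4 \<Longrightarrow> hd cs = 0" for cs
    by (auto simp: A1_def A2_def A3_def A4_def tuples_Hl_def pure_tuples_def monom_eq_0_iff)
  have disj12: "A1 \<inter> A2 = {}"
  proof -
    have "cs \<notin> A2" if cs: "cs \<in> A1" for cs
    proof -
      obtain j where "j \<le> d - 1 - l" "cs = [monom 1 j]" using cs unfolding A1_def by blast
      hence "\<exists>j\<le>d - 1. cs = [monom 1 j]" by (intro exI[of _ j]) simp
      thus ?thesis by (auto simp: A2_def tuples_Hl_def)
    qed
    thus ?thesis by blast
  qed
  have disj34: "A3 \<inter> A4 = {}"
  proof -
    have "cs \<notin> A4" if cs: "cs \<in> A3" for cs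
    proof -
      obtain m j where "j < d" "cs = 0 # (replicate m 0 @ [monom 1 j])"
        using cs unfolding A3_def pure_tuples_def by auto
      moreover from this have "\<exists>i\<le>d - 1. monom 1 j = (monom 1 i :: 'a poly)"
        by (intro exI[of _ j]) simp
      ultimately show ?thesis by (auto simp: A4_def tuples_H_def)
    qed
    thus ?thesis by blast
  qed
  have disj: "A1 \<inter> (A2 \<union> (A3 \<union> A4)) = {}" "A2 \<inter> (A3 \<union> A4) = {}"
    using hd disj12 by blast+
  have "infsum g A1 = zeta_T d l n"
  proof -
    have "infsum g A1 = (\<Sum>cs\<in>A1. g cs)" by (rule infsum_finite) (simp add: A1_def)
    also have "\<dots> = (\<Sum>j\<le>d - 1 - l. g [monom 1 j])"
      unfolding A1_def by (subst sum.reindex) (auto simp: inj_on_def monom_eq_iff')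
    also have "\<dots> = zeta_T d l n"
      unfolding zeta_T_def
      by (intro sum.cong) (simp_all add: g_def tuple_value_def of_A_monom mult.commute flip: power_mult)
    finally show ?thesis .
  qed
  moreover have "infsum g A2 = (\<Sum>\<^sub>\<infinity>cs\<in>tuples_Hl d l. 1 / (\<Sum>i<length cs. of_A (cs ! i) * x ^ i) ^ n)"
    by (simp add: A2_def g_def tuple_value_def)
  moreover have "infsum g A3 = zeta_T d 0 n / (x ^ n - 1)"
  proof (rule infsumI)
    have "1 < absv x" unfolding assms(3) using assms(1) by (intro one_less_power) auto
    thus "(g has_sum zeta_T d 0 n / (x ^ n - 1)) A3"
      unfolding g_def A3_def using assms(1,2) summable[of A3]
      by (intro has_sum_pure_tuples) (auto simp: g_def A3_def)
  qed
  moreover have "infsum g A4 = (\<Sum>\<^sub>\<infinity>cs\<in>tuples_H d. 1 / (\<Sum>i<length cs. of_A (cs ! i) * x ^ (i + 1)) ^ n)"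
    unfolding A4_def
    by (subst infsum_reindex)
       (simp_all add: o_def g_def tuple_value_Cons, simp add: tuple_value_def sum_distrib_left mult_ac)
  moreover have "infsum g (expansion_lists d (d - 1 - l)) = infsum g A1 + (infsum g A2 + (infsum g A3 + infsum g A4))"
  proof -
    have "infsum g (A1 \<union> (A2 \<union> (A3 \<union> A4))) = infsum g A1 + infsum g (A2 \<union> (A3 \<union> A4))"
      by (intro infsum_Un_disjoint summable disj) auto
    also have "infsum g (A2 \<union> (A3 \<union> A4)) = infsum g A2 + infsum g (A3 \<union> A4)"
      by (intro infsum_Un_disjoint summable disj) auto
    also have "infsum g (A3 \<union> A4) = infsum g A3 + infsum g A4"
      by (intro infsum_Un_disjoint summable disj34) auto
    finally show ?thesis unfolding dec .
  qed
  moreover have "infsum g (expansion_lists d (d - 1 - l)) = full_zeta d (d - 1 - l) x n"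
    using L by (rule infsumI)
  ultimately show ?thesis by (simp add: H_l_def H_def add_ac)
qed

section \<open>The limit set\<close>

lemma J_of_J_tilde_factor_nonzero:
  "(TT ^ (CARD('a)\<^sup>2) - TT) / (TT ^ CARD('a) - TT) ^ (CARD('a) + 1) \<noteq> (0 :: 'a::{finite,field} fls)"
proof -
  have "TT ^ m - TT \<noteq> (0 :: 'a fls)" if "m > 1" for m
  proof
    assume "TT ^ m - TT = (0 :: 'a fls)"
    hence "absv (TT ^ m :: 'a fls) = absv (TT :: 'a fls)" by simp
    hence "real CARD('a) ^ m = real CARD('a) ^ 1" by simp
    moreover have "real CARD('a) ^ 1 < real CARD('a) ^ m"
      using that by (intro power_strict_increasing) auto
    ultimately show False by simp
  qed
  from this[of "CARD('a)"] this[of "CARD('a)\<^sup>2"] show ?thesis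
    using one_less_power[of "CARD('a)" 2] by simp
qed

text \<open>The passage from the quotient to the invariant is a Moebius transformation, hence
  injective, including the value infinity.\<close>

lemma inj_j_of_J: "j_of_J (J_of_J_tilde u) = j_of_J (J_of_J_tilde v) \<Longrightarrow> u = v"
  using J_of_J_tilde_factor_nonzero
  by (auto simp: j_of_J_def J_of_J_tilde_def Let_def split: if_splits)

text \<open>The same Moebius transformation is continuous. At its pole the absolute values tend
  to infinity.\<close>

lemma conv_to_j_of_J:
  fixes z :: "'a::{finite,field} fls"
  assumes "\<And>e. e > 0 \<Longrightarrow> \<forall>\<^sub>F i in sequentially. absv (X i - z) < e"
  shows "conv_to (\<lambda>i. j_of_J (J_of_J_tilde (X i))) (j_of_J (J_of_J_tilde z))"
proof -
  define \<kappa> :: "'a fls" where "\<kappa> = (TT ^ (CARD('a)\<^sup>2) - TT) / (TT ^ CARD('a) - TT) ^ (CARD('a) + 1)"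
  define w :: "'a fls \<Rightarrow> 'a fls" where "w = (\<lambda>u. 1 / (TT ^ CARD('a) - TT) - \<kappa> * u)"
  have j: "j_of_J (J_of_J_tilde u) = (if w u = 0 then None else Some (1 / w u))" for u
    by (simp add: j_of_J_def J_of_J_tilde_def Let_def w_def \<kappa>_def)
  have \<kappa>: "absv \<kappa> > 0" using J_of_J_tilde_factor_nonzero[where 'a='a] by (simp add: \<kappa>_def)
  have "absv (w (X i) - w z) = absv \<kappa> * absv (X i - z)" for i
  proof -
    have "w (X i) - w z = \<kappa> * (z - X i)" by (simp add: w_def algebra_simps)
    thus ?thesis by (simp add: absv_minus_commute[of z])
  qed
  hence ev: "\<forall>\<^sub>F i in sequentially. absv (w (X i) - w z) < e" if "e > 0" for e
    using assms[of "e / absv \<kappa>"] that \<kappa> by (simp add: pos_less_divide_eq mult.commute)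
  show ?thesis
  proof (cases "w z = 0")
    case True
    have "\<forall>\<^sub>F i in sequentially. \<forall>v. j_of_J (J_of_J_tilde (X i)) = Some v \<longrightarrow> B < absv v" for B
    proof -
      define B' where "B' = max B 1"
      have "\<forall>\<^sub>F i in sequentially. absv (w (X i) - w z) < 1 / B'" by (rule ev) (simp add: B'_def)
      thus ?thesis
      proof eventually_elim
        case (elim i)
        have "B' > 0" "B \<le> B'" by (simp_all add: B'_def)
        have "B < 1 / absv (w (X i))" if "w (X i) \<noteq> 0"
        proof -
          have pos: "absv (w (X i)) > 0" using that by simp
          have "B' < 1 / absv (w (X i))"
            using elim True pos \<open>B' > 0\<close> by (simp add: field_simps)
          thus ?thesis using \<open>B \<le> B'\<close> by linarith
        qed
        thus ?case by (simp add: j)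
      qed
    qed
    thus ?thesis using True by (simp add: conv_to_def j)
  next
    case False
    have "\<forall>\<^sub>F i in sequentially. \<exists>v. j_of_J (J_of_J_tilde (X i)) = Some v \<and> absv (v - 1 / w z) < e"
      if "e > 0" for e
    proof -
      have "absv (w z) > 0" using False by simp
      hence "\<forall>\<^sub>F i in sequentially. absv (w (X i) - w z) < absv (w z)"
        "\<forall>\<^sub>F i in sequentially. absv (w (X i) - w z) < e * (absv (w z) * absv (w z))"
        using that by (intro ev; simp)+
      thus ?thesis
      proof eventually_elim
        case (elim i)
        have eq: "absv (w (X i)) = absv (w z)" using elim(1) by (rule absv_eq_of_close)
        hence nz: "w (X i) \<noteq> 0" using False by auto
        have "1 / w (X i) - 1 / w z = (w z - w (X i)) / (w (X i) * w z)"
          using nz False by (simp add: field_simps)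
        hence "absv (1 / w (X i) - 1 / w z) = absv (w (X i) - w z) / (absv (w z) * absv (w z))"
          by (simp add: eq absv_minus_commute)
        also have "\<dots> < e" using elim(2) False by (simp add: pos_divide_less_eq)
        finally show ?case using nz by (simp add: j)
      qed
    qed
    thus ?thesis using False by (simp add: conv_to_def j)
  qed
qed

lemma conv_to_unique:
  assumes "conv_to X L" "conv_to X L'"
  shows "L = L'"
proof -
  have False if L: "conv_to X (Some u)" "conv_to X None" for u
  proof -
    have "\<forall>\<^sub>F i in sequentially. \<exists>v. X i = Some v \<and> absv (v - u) < 1"
      "\<forall>\<^sub>F i in sequentially. \<forall>v. X i = Some v \<longrightarrow> max 1 (absv u) < absv v"
      using L zero_less_one unfolding conv_to_def option.case by blast+
    hence "\<forall>\<^sub>F i in sequentially. False"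
    proof eventually_elim
      case (elim i)
      then obtain v where v: "absv (v - u) < 1" "max 1 (absv u) < absv v" by blast
      have "absv (v - u + u) \<le> max 1 (absv u)" using v(1) by (intro absv_add_leI) auto
      thus False using v(2) by simp
    qed
    thus False by simp
  qed
  moreover have "u = v" if L: "conv_to X (Some u)" "conv_to X (Some v)" for u v
  proof (rule ccontr)
    assume "u \<noteq> v"
    hence pos: "absv (u - v) > 0" by simp
    have "\<forall>\<^sub>F i in sequentially. \<exists>w. X i = Some w \<and> absv (w - u) < absv (u - v)"
      "\<forall>\<^sub>F i in sequentially. \<exists>w. X i = Some w \<and> absv (w - v) < absv (u - v)"
      using L pos by (simp_all only: conv_to_def option.case)
    hence "\<forall>\<^sub>F i in sequentially. False"
    proof eventually_elim
      case (elim i)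
      then obtain w where w: "absv (w - u) < absv (u - v)" "absv (w - v) < absv (u - v)" by force
      have "absv ((w - v) - (w - u)) < absv (u - v)" using w(2,1) by (rule absv_diff_lessI)
      thus False by simp
    qed
    thus False by simp
  qed
  ultimately show ?thesis using assms by (cases L; cases L') blast+
qed

lemma conv_to_subseq:
  assumes "conv_to X L" "strict_mono r"
  shows "conv_to (\<lambda>i. X (r i)) L"
proof -
  have "filterlim r sequentially sequentially" using assms(2) by (rule filterlim_subseq)
  thus ?thesis
    using assms(1) unfolding conv_to_def
    by (auto split: option.splits dest: eventually_compose_filterlim)
qed

context quadratic_unit
begin

definition limit_value :: "nat \<Rightarrow> 'a fls option" where
  "limit_value l = j_of_J (J_of_J_tilde (zeta_ratio d (d - 1 - l) x))"

text \<open>The range of \<epsilon> for which the monic elements of \<Lambda> are the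
  combinations that start at index N with lowest digit of degree at most d - 1 - l.\<close>

definition in_window :: "nat \<Rightarrow> nat \<Rightarrow> real \<Rightarrow> bool" where
  "in_window N l \<epsilon> \<longleftrightarrow> real CARD('a) ^ (d - 1 - l) / real CARD('a) ^ ((N + 1) * d) < \<epsilon> \<and>
     \<epsilon> \<le> real CARD('a) ^ Suc (d - 1 - l) / real CARD('a) ^ ((N + 1) * d)"

text \<open>With M the least exponent such that q^(-M) < \<epsilon>, the distances below
  \<epsilon> are those of size at most q^(-M), and M - 1 = N d + l.\<close>

lemma ex_window:
  assumes "0 < \<epsilon>" "\<epsilon> \<le> 1"
  shows "\<exists>N l. l < d \<and> in_window N l \<epsilon>"
proof -
  let ?q = "real CARD('a)"
  define M where "M = (LEAST M. 1 / ?q ^ M < \<epsilon>)"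
  obtain M0 where "?q powi (- int M0) < \<epsilon>" using ex_powi_less[OF assms(1)] by blast
  hence "1 / ?q ^ M0 < \<epsilon>" by (simp add: power_int_minus inverse_eq_divide)
  hence M: "1 / ?q ^ M < \<epsilon>" unfolding M_def by (rule LeastI)
  have "M \<noteq> 0" using M assms(2) by (cases M) auto
  then obtain K where K: "M = Suc K" by (cases M) auto
  have K': "\<epsilon> \<le> 1 / ?q ^ K" using not_less_Least[of K "\<lambda>M. 1 / ?q ^ M < \<epsilon>"] K M_def by auto
  define N l where "N = K div d" and "l = K mod d"
  have l: "l < d" using deg_pos by (simp add: l_def)
  have NK: "N * d + l = K" by (simp add: N_def l_def)
  have e1: "(N + 1) * d = (d - 1 - l) + M" and e2: "(N + 1) * d = Suc (d - 1 - l) + K"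
    using NK l K by simp_all
  have "?q ^ (d - 1 - l) / ?q ^ ((N + 1) * d) = 1 / ?q ^ M"
    unfolding e1 power_add by simp
  moreover have "?q ^ Suc (d - 1 - l) / ?q ^ ((N + 1) * d) = 1 / ?q ^ K"
    unfolding e2 power_add by (simp del: power_Suc)
  ultimately show ?thesis using M K' l unfolding in_window_def by (intro exI[of _ N] exI[of _ l]) simp
qed

text \<open>As \<epsilon> tends to 0 the index N of its window tends to infinity, and with it
  the precision of the approximation.\<close>

lemma conv_to_limit_value:
  assumes "\<epsilon> \<longlonglongrightarrow> 0" "\<And>i. in_window (N i) l (\<epsilon> i)" "l < d"
  shows "conv_to (\<lambda>i. j_eps x (\<epsilon> i)) (limit_value l)"
  unfolding j_eps_def limit_value_def
proof (rule conv_to_j_of_J)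
  let ?q = "real CARD('a)"
  fix e :: real assume "e > 0"
  then obtain M where "?q powi (- int M) < e" using ex_powi_less by blast
  hence M: "1 / ?q ^ M < e" by (simp add: power_int_minus inverse_eq_divide)
  have "\<forall>\<^sub>F i in sequentially. \<epsilon> i < 1 / ?q ^ (M * d)"
    using assms(1) by (rule order_tendstoD) simp
  thus "\<forall>\<^sub>F i in sequentially. absv (J_tilde_eps x (\<epsilon> i) - zeta_ratio d (d - 1 - l) x) < e"
  proof eventually_elim
    case (elim i)
    note w = assms(2)[of i, unfolded in_window_def]
    have "1 / ?q ^ ((N i + 1) * d) \<le> ?q ^ (d - 1 - l) / ?q ^ ((N i + 1) * d)"
      by (intro divide_right_mono one_le_power) auto
    hence "1 / ?q ^ ((N i + 1) * d) < 1 / ?q ^ (M * d)" using w elim by linarith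
    hence "?q ^ (M * d) < ?q ^ ((N i + 1) * d)" by (simp add: divide_simps)
    hence "M * d < (N i + 1) * d" by (rule power_less_imp_less_exp[rotated]) simp
    hence "M \<le> N i + 1" using mult_less_cancel2[of M d "N i + 1"] by linarith
    hence "?q ^ M \<le> ?q ^ (N i + 1)" by (intro power_increasing) auto
    hence "1 / ?q ^ (N i + 1) \<le> 1 / ?q ^ M" by (intro divide_left_mono) auto
    moreover have "absv (J_tilde_eps x (\<epsilon> i) - zeta_ratio d (d - 1 - l) x) \<le> 1 / ?q ^ (N i + 1)"
      using w assms(3) by (intro J_tilde_eps_close) auto
    ultimately show ?case using M by linarith
  qed
qed

lemma limit_value_in_j_qt:
  assumes "l < d"
  shows "limit_value l \<in> j_qt x"
proof -
  let ?q = "real CARD('a)"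
  \<comment> \<open>The upper ends of the successive windows with the given l.\<close>
  define \<epsilon> where "\<epsilon> = (\<lambda>i::nat. ?q ^ Suc (d - 1 - l) / ?q ^ ((i + 1) * d))"
  have lim: "\<epsilon> \<longlonglongrightarrow> 0"
  proof -
    have "(\<lambda>i. (1 / ?q ^ d) ^ i) \<longlonglongrightarrow> 0"
      using one_less_power[of ?q d] deg_pos by (intro LIMSEQ_realpow_zero) auto
    from tendsto_mult_right_zero[OF this, of "?q ^ Suc (d - 1 - l) / ?q ^ d"]
    have "(\<lambda>i. ?q ^ Suc (d - 1 - l) / ?q ^ d * (1 / ?q ^ d) ^ i) \<longlonglongrightarrow> 0" by simp
    also have "(\<lambda>i. ?q ^ Suc (d - 1 - l) / ?q ^ d * (1 / ?q ^ d) ^ i) = \<epsilon>"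
      unfolding \<epsilon>_def
      by (simp add: fun_eq_iff power_one_over power_add add_mult_distrib power_mult[symmetric] mult.commute[of d])
    finally show ?thesis .
  qed
  have win: "in_window i l (\<epsilon> i)" for i
    unfolding in_window_def \<epsilon>_def by (intro conjI divide_strict_right_mono power_strict_increasing) auto
  have "\<epsilon> i > 0" for i by (simp add: \<epsilon>_def)
  thus ?thesis
    using lim conv_to_limit_value[OF lim win assms] unfolding j_qt_def by blast
qed

text \<open>Some l occurs infinitely often among the windows of the sequence, and along that
  subsequence the limit is known.\<close>

lemma j_qt_subset: "j_qt x \<subseteq> limit_value ` {..<d}"
proof
  fix L assume "L \<in> j_qt x"
  then obtain \<epsilon> :: "nat \<Rightarrow> real" where \<epsilon>: "\<And>i. \<epsilon> i > 0" "\<epsilon> \<longlonglongrightarrow> 0"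
    "conv_to (\<lambda>i. j_eps x (\<epsilon> i)) L" by (auto simp: j_qt_def)
  have "\<forall>\<^sub>F i in sequentially. \<epsilon> i < 1" using \<epsilon>(2) by (rule order_tendstoD) simp
  then obtain i0 where i0: "\<And>i. i \<ge> i0 \<Longrightarrow> \<epsilon> i < 1" by (auto simp: eventually_sequentially)
  have "\<forall>i\<in>{i0..}. \<exists>l\<in>{..<d}. \<exists>N. in_window N l (\<epsilon> i)"
    using ex_window[OF \<epsilon>(1)] i0 by (meson atLeast_iff lessThan_iff less_imp_le)
  from pigeonhole_infinite_rel[OF _ _ this]
  obtain l where l: "l < d" "infinite {i \<in> {i0..}. \<exists>N. in_window N l (\<epsilon> i)}"
    by (auto simp: infinite_Ici)
  define r where "r = enumerate {i \<in> {i0..}. \<exists>N. in_window N l (\<epsilon> i)}"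
  have r: "strict_mono r" unfolding r_def by (rule strict_mono_enumerate) (rule l(2))
  have "\<exists>N. in_window N l (\<epsilon> (r i))" for i
    using enumerate_in_set[OF l(2), of i] by (simp add: r_def)
  then obtain N where N: "\<And>i. in_window (N i) l (\<epsilon> (r i))" by metis
  have "(\<lambda>i. \<epsilon> (r i)) \<longlonglongrightarrow> 0" using LIMSEQ_subseq_LIMSEQ[OF \<epsilon>(2) r] by (simp add: o_def)
  from conv_to_limit_value[OF this N l(1)] conv_to_subseq[OF \<epsilon>(3) r]
  have "L = limit_value l" by (rule conv_to_unique[symmetric])
  thus "L \<in> limit_value ` {..<d}" using l(1) by simp
qed

lemma j_qt_eq: "j_qt x = limit_value ` {..<d}"
  using j_qt_subset limit_value_in_j_qt by blast

lemma inj_on_limit_value: "inj_on limit_value {..<d}"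
proof (rule linorder_inj_onI)
  fix l m assume lm: "l < m" "l \<in> {..<d}" "m \<in> {..<d}"
  have "zeta_ratio d (d - 1 - m) x \<noteq> zeta_ratio d (d - 1 - l) x"
    using lm by (intro zeta_ratio_distinct absv_x) auto
  thus "limit_value l \<noteq> limit_value m"
    unfolding limit_value_def using inj_j_of_J by metis
qed auto

end

section \<open>Reduction to the normalised root\<close>

text \<open>Translation by a polynomial and multiplication by a nonzero constant both permute A
  and preserve absolute values.\<close>

lemma dist_A_affine:
  assumes "c \<noteq> 0"
  shows "dist_A (of_A r + fls_const c * z) = dist_A z"
proof -
  have "(\<exists>\<alpha>. t = absv (of_A r + fls_const c * z - of_A \<alpha>)) \<longleftrightarrow> (\<exists>\<alpha>. t = absv (z - of_A \<alpha>))" for t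
  proof
    assume "\<exists>\<alpha>. t = absv (of_A r + fls_const c * z - of_A \<alpha>)"
    then obtain \<alpha> where t: "t = absv (of_A r + fls_const c * z - of_A \<alpha>)" by blast
    define \<beta> where "\<beta> = smult (inverse c) (\<alpha> - r)"
    have "smult c \<beta> = \<alpha> - r" using assms by (simp add: \<beta>_def)
    hence "fls_const c * of_A \<beta> = of_A \<alpha> - of_A r" by (metis of_A_smult of_A_diff)
    hence "of_A r + fls_const c * z - of_A \<alpha> = fls_const c * (z - of_A \<beta>)" by (simp add: right_diff_distrib)
    hence "t = absv (z - of_A \<beta>)" using assms by (simp only: t absv_mult) (simp add: absv_const)
    thus "\<exists>\<alpha>. t = absv (z - of_A \<alpha>)" by blast
  next
    assume "\<exists>\<alpha>. t = absv (z - of_A \<alpha>)"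
    then obtain \<alpha> where t: "t = absv (z - of_A \<alpha>)" by blast
    have "of_A r + fls_const c * z - of_A (r + smult c \<alpha>) = fls_const c * (z - of_A \<alpha>)"
      by (simp add: right_diff_distrib)
    hence "t = absv (of_A r + fls_const c * z - of_A (r + smult c \<alpha>))"
      using assms by (simp only: t absv_mult) (simp add: absv_const)
    thus "\<exists>\<alpha>. t = absv (of_A r + fls_const c * z - of_A \<alpha>)" by blast
  qed
  thus ?thesis by (simp only: dist_A_def)
qed

lemma j_qt_affine:
  assumes "c \<noteq> 0"
  shows "j_qt (of_A r + fls_const c * z) = j_qt z"
proof -
  have "dist_A (of_A p * (of_A r + fls_const c * z)) = dist_A (of_A p * z)" for p
    using dist_A_affine[OF assms, of "p * r" "of_A p * z"] by (simp add: algebra_simps)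
  hence "Lam_mon (of_A r + fls_const c * z) = Lam_mon z"
    by (simp add: fun_eq_iff Lam_mon_def Lam_def)
  hence "j_eps (of_A r + fls_const c * z) = j_eps z"
    by (simp add: fun_eq_iff j_eps_def J_tilde_eps_def zeta_def)
  thus ?thesis by (simp add: j_qt_def)
qed

lemma quad_poly_root_iff:
  "poly (quad_poly a b) z = 0 \<longleftrightarrow> z\<^sup>2 = of_A a * z + fls_const b"
  by (simp add: quad_poly_def power2_eq_square algebra_simps)

lemma fls_two_nonzero: "CHAR('a::{finite,field}) \<noteq> 2 \<Longrightarrow> (2 :: 'a fls) \<noteq> 0"
proof
  assume *: "CHAR('a) \<noteq> 2" "(2 :: 'a fls) = 0"
  hence "fls_const (2 :: 'a) = 0" by simp
  hence "of_nat 2 = (0 :: 'a)" by (simp only: fls_const_eq_0_iff of_nat_numeral)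
  hence "CHAR('a) dvd 2" by (simp only: of_nat_eq_0_iff_char_dvd)
  hence "CHAR('a) \<le> 2" by (intro dvd_imp_le) simp_all
  moreover have "CHAR('a) \<noteq> 0" using \<open>CHAR('a) dvd 2\<close> by (intro notI) simp
  ultimately show False using * CHAR_not_1[where 'a='a] by linarith
qed

lemma conjugate_root:
  assumes "z\<^sup>2 = of_A a * z + fls_const b"
  shows "(of_A a - z)\<^sup>2 = of_A a * (of_A a - z) + fls_const b" "z * (of_A a - z) = - fls_const b"
  using assms by (simp_all add: power2_eq_square algebra_simps)

theorem theorem1:
  fixes a :: "'a::{finite,field} poly" and b :: 'a and f :: "'a fls"
  assumes "degree a > 0"
    and "b \<noteq> 0"
    and "poly (quad_poly a b) f = 0"
  shows "finite (j_qt f) \<and> card (j_qt f) = degree a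
    \<and> real (degree a) = log (real CARD('a)) (absv (sqrt_discr a b))
    \<and> j_qt f = (\<lambda>l. j_l a b l) ` {0..degree a - 1}"
proof -
  let ?q = "real CARD('a)"
  have a: "a \<noteq> 0" using assms(1) by auto
  have root_f: "f\<^sup>2 = of_A a * f + fls_const b"
    using assms(3) by (simp add: quad_poly_root_iff)
  have "absv (of_A a) > 1"
    using absv_of_A[OF a] one_less_power[of ?q "degree a"] assms(1) by simp
  hence "absv f > 1 \<or> absv (of_A a - f) > 1"
    using absv_add_leI[of f 1 "of_A a - f"] by fastforce
  then obtain u where u: "absv u > 1" "u\<^sup>2 = of_A a * u + fls_const b" "f = u \<or> f = of_A a - u"
  proof
    assume "absv f > 1"
    thus ?thesis using that[of f] root_f by simp
  next
    assume "absv (of_A a - f) > 1"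
    thus ?thesis using that[of "of_A a - f"] conjugate_root(1)[OF root_f] by simp
  qed
  have "absv u * absv (of_A a - u) = 1"
    using conjugate_root(2)[OF u(2)] assms(2) by (simp add: absv_const flip: absv_mult)
  hence small: "absv (of_A a - u) < 1"
    using u(1) by (metis absv_nonneg less_1_mult linorder_neqE_linordered_idom mult.commute mult.right_neutral less_irrefl)
  have f_plus: "f_plus a b = u"
    unfolding f_plus_def
  proof (rule the_equality)
    show "poly (quad_poly a b) u = 0 \<and> absv u > 1" using u by (simp add: quad_poly_root_iff)
    fix v assume v: "poly (quad_poly a b) v = 0 \<and> absv v > 1"
    hence "v\<^sup>2 = of_A a * v + fls_const b" by (simp add: quad_poly_root_iff)
    hence "(v - u) * (v - (of_A a - u)) = 0"
      using u(2) by (simp add: power2_eq_square algebra_simps)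
    thus "v = u" using v small by auto
  qed
  define c where "c = inverse (lead_coeff a)"
  have c: "c \<noteq> 0" using a by (simp add: c_def)
  have monic_c: "monic (smult c a)" using a by (simp add: monic_def c_def)
  have "(THE c. c \<noteq> 0 \<and> monic (smult c a)) = c"
  proof (rule the_equality)
    show "c \<noteq> 0 \<and> monic (smult c a)" using c monic_c by simp
    fix e assume "e \<noteq> 0 \<and> monic (smult e a)"
    thus "e = c" using a by (auto simp: monic_def c_def field_simps)
  qed
  hence f_bar: "f_bar a b = fls_const c * u" by (simp add: f_bar_def f_plus)
  interpret quadratic_unit "smult c a" "c\<^sup>2 * b" "fls_const c * u"
  proof
    show "degree (smult c a) > 0" using assms(1) c by simp
    show "monic (smult c a)" by (rule monic_c)
    show "c\<^sup>2 * b \<noteq> 0" using c assms(2) by simp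
    show "(fls_const c * u)\<^sup>2 = of_A (smult c a) * (fls_const c * u) + fls_const (c\<^sup>2 * b)"
      unfolding power_mult_distrib u(2)
      by (simp add: algebra_simps power2_eq_square flip: fls_const_mult_const)
    show "absv (fls_const c * u) > 1" using u(1) c by (simp add: absv_const)
  qed
  have d: "degree (smult c a) = degree a" using c by simp
  have absv_u: "absv u = ?q ^ degree a"
    using absv_x c by (simp add: absv_const)
  have lims: "j_l a b l = limit_value l" for l
    unfolding j_l_def J_tilde_def Let_def f_bar limit_value_def zeta_ratio_def d
    using H_l_plus_H[of "degree a" _ "fls_const c * u" l] absv_x card_field_exponents_pos[where 'a='a] assms(1) d
    by (simp del: One_nat_def)
  have scaled: "j_qt (fls_const c * u) = j_qt u"
    using j_qt_affine[OF c, of 0 u] by simp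
  have "j_qt f = j_qt u"
    using u(3)
  proof
    assume "f = of_A a - u"
    thus ?thesis using j_qt_affine[of "-1" a u] by simp
  qed simp
  hence "j_qt f = limit_value ` {..<degree a}"
    using j_qt_eq scaled d by simp
  moreover have "{..<degree a} = {0..degree a - 1}" using assms(1) by auto
  moreover have "card (limit_value ` {..<degree a}) = degree a"
    using card_image[OF inj_on_limit_value] d by simp
  moreover have "absv (sqrt_discr a b) = ?q ^ degree a"
  proof (cases "CHAR('a) = 2")
    case True
    thus ?thesis using a by (simp add: sqrt_discr_def absv_of_A)
  next
    case False
    have two: "(2 :: 'a fls) \<noteq> 0" using False by (rule fls_two_nonzero)
    \<comment> \<open>The square root of the discriminant is the difference of the two roots.\<close>
    define s where "s = u - (of_A a - u)"
    have "of_A (4 * [:b:]) = 4 * fls_const b"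
    proof -
      have "(4 :: 'a poly) = 1 + 1 + 1 + 1" by simp
      hence "of_A (4 :: 'a poly) = 1 + 1 + 1 + 1" by (simp only: of_A_add of_A_1)
      thus ?thesis by (simp only: of_A_mult) simp
    qed
    hence D: "of_A (discr a b) = (of_A a)\<^sup>2 + 4 * fls_const b"
      by (simp add: discr_def power2_eq_square)
    have "s\<^sup>2 = 4 * (u\<^sup>2 - of_A a * u) + (of_A a)\<^sup>2"
      by (simp add: s_def power2_eq_square algebra_simps)
    hence s: "s\<^sup>2 = of_A (discr a b)" using u(2) D by simp
    have "(THE s. s\<^sup>2 = of_A (discr a b) \<and> f_plus a b = (of_A a + s) / 2) = s"
    proof (rule the_equality)
      show "s\<^sup>2 = of_A (discr a b) \<and> f_plus a b = (of_A a + s) / 2"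
        using s two by (simp add: f_plus s_def field_simps)
      fix t assume "t\<^sup>2 = of_A (discr a b) \<and> f_plus a b = (of_A a + t) / 2"
      hence "2 * u = of_A a + t" using two by (simp add: f_plus field_simps)
      thus "t = s" by (simp add: s_def algebra_simps)
    qed
    hence "sqrt_discr a b = s" using False by (simp add: sqrt_discr_def)
    moreover have "absv s = absv u"
      unfolding s_def using small u(1) by (intro absv_diff_dominant) linarith
    ultimately show ?thesis using absv_u by simp
  qed
  moreover have "log ?q (?q ^ degree a) = real (degree a)"
    by (rule log_pow_cancel) (use card_field_gt_1[where 'a='a] in linarith)+
  ultimately show ?thesis using lims by simp
qed

end
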